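(* Let $p$ be a prime and let $R$ be a finite noncommutative local unital ring with residue field $F_p$ (that is, $R/J\cong F_p$, where $J$ is the Jacobson radical of $R$). Then $R$ surjects onto $F_p[x,y]/(x^2,xy,y^2)$ and $\sigma(R)=p+1$. In particular, $R\notin S(p+1)$.
   Context: Rings are associative; subrings are not required to contain the multiplicative identity, nor any identity. The covering number $\sigma(R)$ is the minimal number of proper subrings whose union is $R$, with $\sigma(R)=\infty$ if there is no finite such collection. For $n\geq 3$, $S(n)$ is the collection of isomorphism classes of unital rings $R$ such that $\sigma(R)=n$ and $\sigma(R/I)>n$ for every nonzero two-sided ideal $I$ of $R$. $F_p$ is the field with $p$ elements. *)

theory Defs
  imports
    "HOL-Algebra.UnivPoly"
    "HOL-Algebra.QuotRing"
    "HOL-Number_Theory.Residues"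
    "HOL-Library.Extended_Nat"
begin

(* The library's subring locale demands \<one> \<in> H; here subrings need not contain any identity. *)
definition subrng :: "'a set \<Rightarrow> ('a, 'b) ring_scheme \<Rightarrow> bool"
  where "subrng H R \<longleftrightarrow>
    additive_subgroup H R \<and> (\<forall>x\<in>H. \<forall>y\<in>H. x \<otimes>\<^bsub>R\<^esub> y \<in> H)"

definition subrng_cover :: "'a set set \<Rightarrow> ('a, 'b) ring_scheme \<Rightarrow> bool"
  where "subrng_cover C R \<longleftrightarrow>
    (\<forall>H\<in>C. subrng H R \<and> H \<noteq> carrier R) \<and> \<Union>C = carrier R"

(* The infimum is attained if a finite cover exists, and is Inf {} = \<infinity> otherwise. *)
definition covering_number :: "('a, 'b) ring_scheme \<Rightarrow> enat"
  where "covering_number R = Inf {enat (card C) | C. finite C \<and> subrng_cover C R}"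

(* Membership of (the isomorphism class of) R in S(n); the class S(n) is considered for n \<ge> 3.
   As in HOL-Algebra, ring means unital associative ring, and ideal means two-sided ideal. *)
definition in_S :: "nat \<Rightarrow> ('a, 'b) ring_scheme \<Rightarrow> bool"
  where "in_S n R \<longleftrightarrow>
    ring R \<and> covering_number R = enat n \<and>
    (\<forall>I. ideal I R \<and> I \<noteq> {\<zero>\<^bsub>R\<^esub>} \<longrightarrow> covering_number (R Quot I) > enat n)"

definition left_ideal :: "'a set \<Rightarrow> ('a, 'b) ring_scheme \<Rightarrow> bool"
  where "left_ideal I R \<longleftrightarrow>
    additive_subgroup I R \<and> (\<forall>a\<in>I. \<forall>x\<in>carrier R. x \<otimes>\<^bsub>R\<^esub> a \<in> I)"

definition maximal_left_ideal :: "'a set \<Rightarrow> ('a, 'b) ring_scheme \<Rightarrow> bool"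
  where "maximal_left_ideal M R \<longleftrightarrow>
    left_ideal M R \<and> M \<noteq> carrier R \<and>
    (\<forall>I. left_ideal I R \<and> M \<subseteq> I \<longrightarrow> I = M \<or> I = carrier R)"

definition jacobson_radical :: "('a, 'b) ring_scheme \<Rightarrow> 'a set"
  where "jacobson_radical R = carrier R \<inter> \<Inter>{M. maximal_left_ideal M R}"

(* Commutativity is not assumed. *)
definition local_ring :: "('a, 'b) ring_scheme \<Rightarrow> bool"
  where "local_ring R \<longleftrightarrow> ring R \<and> (\<exists>!M. maximal_left_ideal M R)"

(* Bivariate polynomials K[x,y] are taken as the iterated univariate ring K[x][y]. *)
abbreviation UP2 :: "('a, 'b) ring_scheme \<Rightarrow> (nat \<Rightarrow> 'a, nat \<Rightarrow> nat \<Rightarrow> 'a) up_ring"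
  where "UP2 K \<equiv> UP (UP K)"

definition UP2_x :: "('a, 'b) ring_scheme \<Rightarrow> nat \<Rightarrow> nat \<Rightarrow> 'a"
  where "UP2_x K = monom (UP2 K) (monom (UP K) \<one>\<^bsub>K\<^esub> 1) 0"

definition UP2_y :: "('a, 'b) ring_scheme \<Rightarrow> nat \<Rightarrow> nat \<Rightarrow> 'a"
  where "UP2_y K = monom (UP2 K) \<one>\<^bsub>UP K\<^esub> 1"

(* K[x,y]/(x^2, xy, y^2) *)
definition square_zero_quot :: "('a, 'b) ring_scheme \<Rightarrow> (nat \<Rightarrow> nat \<Rightarrow> 'a) set ring"
  where "square_zero_quot K =
    UP2 K Quot (Idl\<^bsub>UP2 K\<^esub>
      {UP2_x K \<otimes>\<^bsub>UP2 K\<^esub> UP2_x K,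
       UP2_x K \<otimes>\<^bsub>UP2 K\<^esub> UP2_y K,
       UP2_y K \<otimes>\<^bsub>UP2 K\<^esub> UP2_y K})"

end

theory Submission
  imports Defs "HOL-Algebra.Ideal_Product"
begin

text \<open>
  Let \<open>\<Phi> = J\<^sup>2 + p R\<close>. Nakayama's lemma makes \<open>J\<close> nilpotent, so if \<open>J/\<Phi>\<close> were generated by one
  element \<open>a\<close>, then \<open>1\<close> and \<open>a\<close> would generate the ring \<open>R = \<int> + J\<close>, which would be commutative.
  Hence \<open>J/\<Phi>\<close> has dimension at least \<open>2\<close> over \<open>F\<^sub>p\<close>. Every additive group \<open>K\<close> between \<open>\<Phi>\<close> and \<open>J\<close>
  is an ideal, and choosing it of codimension \<open>2\<close> in \<open>J\<close> gives \<open>R/K \<cong> F\<^sub>p[x,y]/(x\<^sup>2, xy, y\<^sup>2)\<close>. The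
  \<open>p + 1\<close> lines of \<open>J/K\<close> yield a cover of \<open>R/K\<close>, and of \<open>R\<close>, by \<open>p + 1\<close> proper subrings; since \<open>R/K\<close>
  is commutative, \<open>K \<noteq> 0\<close> and \<open>R \<notin> S(p + 1)\<close>. Conversely, \<open>(R, +)\<close> is a finite \<open>p\<close>-group, so proper
  subgroups have index at least \<open>p\<close>, and \<open>p\<close> of them cannot cover \<open>R\<close>.
\<close>

section \<open>Finite local rings\<close>

lemma (in ring) additive_subgroup_of_closed:
  assumes "H \<subseteq> carrier R" "\<zero> \<in> H"
    and "\<And>x y. x \<in> H \<Longrightarrow> y \<in> H \<Longrightarrow> x \<oplus> y \<in> H" "\<And>x. x \<in> H \<Longrightarrow> \<ominus> x \<in> H"
  shows "additive_subgroup H R"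
  by (rule additive_subgroupI, rule subgroup.intro) (use assms in \<open>auto simp: a_inv_def[symmetric]\<close>)

lemma (in ring) additive_subgroup_minus_closed:
  assumes "additive_subgroup H R" "x \<in> H" "y \<in> H"
  shows "x \<ominus> y \<in> H"
  using assms
  by (simp add: a_minus_def additive_subgroup.a_closed abelian_group.a_inv_closed
      additive_subgroup.a_inv_closed is_abelian_group)

lemma (in ring) additive_subgroup_int_mult_closed:
  fixes k :: int
  assumes "additive_subgroup H R" "x \<in> H"
  shows "[k] \<cdot> x \<in> H"
  using add.subgroup_int_pow_closed assms by (simp add: additive_subgroup_def)

text \<open>Left multiplication by \<open>r\<close> is injective because \<open>z\<close> undoes it,
  so on a finite ring it is surjective. A preimage \<open>s\<close> of \<open>1\<close> is a right
  inverse of \<open>r\<close>, and associativity forces \<open>s = z\<close>.\<close>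

lemma (in ring) finite_left_inverse_imp_right_inverse:
  assumes fin: "finite (carrier R)" and z: "z \<in> carrier R" and r: "r \<in> carrier R"
    and zr: "z \<otimes> r = \<one>"
  shows "r \<otimes> z = \<one>"
proof -
  have "inj_on (\<lambda>s. r \<otimes> s) (carrier R)"
  proof (rule inj_onI)
    fix s t assume st: "s \<in> carrier R" "t \<in> carrier R" "r \<otimes> s = r \<otimes> t"
    then have "z \<otimes> r \<otimes> s = z \<otimes> r \<otimes> t" using z r by (simp add: m_assoc)
    then show "s = t" using zr st by simp
  qed
  then have "(\<lambda>s. r \<otimes> s) ` carrier R = carrier R"
    by (intro endo_inj_surj[OF fin]) (use r in auto)
  then obtain s where s: "s \<in> carrier R" "r \<otimes> s = \<one>" by (metis imageE one_closed)
  have "s = z \<otimes> r \<otimes> s" using zr s by simp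
  also have "\<dots> = z" using s z r by (simp add: m_assoc)
  finally show ?thesis using s by simp
qed

lemma (in ring) proper_left_ideal_subset_maximal:
  assumes fin: "finite (carrier R)" and "left_ideal I R" "I \<noteq> carrier R"
  shows "\<exists>M. maximal_left_ideal M R \<and> I \<subseteq> M"
proof -
  let ?F = "{L. left_ideal L R \<and> L \<noteq> carrier R \<and> I \<subseteq> L}"
  have sub: "L \<subseteq> carrier R" if "left_ideal L R" for L
    using that additive_subgroup.a_subset[of L R] by (auto simp: left_ideal_def)
  have "finite ?F"
    by (rule finite_subset[of _ "Pow (carrier R)"]) (use fin sub in auto)
  moreover have "I \<in> ?F" using assms by auto
  ultimately obtain M where M: "M \<in> ?F" "\<forall>L \<in> ?F. M \<subseteq> L \<longrightarrow> M = L"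
    using finite_has_maximal[of ?F] by auto
  then have "maximal_left_ideal M R" unfolding maximal_left_ideal_def by blast
  then show ?thesis using M by blast
qed

text \<open>Two instances matter: \<open>R x\<close>, from \<open>I = carrier R\<close> and
  \<open>N = {0}\<close>, and the left ideal \<open>I x + N\<close> in
  \<open>nakayama\<close>.\<close>

lemma (in ring) left_ideal_principal_add:
  assumes "left_ideal I R" "left_ideal N R" "x \<in> carrier R"
  shows "left_ideal {i \<otimes> x \<oplus> n | i n. i \<in> I \<and> n \<in> N} R" (is "left_ideal ?S R")
proof -
  have I: "additive_subgroup I R" "\<And>a r. a \<in> I \<Longrightarrow> r \<in> carrier R \<Longrightarrow> r \<otimes> a \<in> I"
    and N: "additive_subgroup N R" "\<And>a r. a \<in> N \<Longrightarrow> r \<in> carrier R \<Longrightarrow> r \<otimes> a \<in> N"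
    using assms by (auto simp: left_ideal_def)
  note c = additive_subgroup.a_Hcarr[OF I(1)] additive_subgroup.a_Hcarr[OF N(1)]
  note cl = additive_subgroup.a_closed[OF I(1)] additive_subgroup.a_closed[OF N(1)]
    additive_subgroup.a_inv_closed[OF I(1)]
    additive_subgroup.a_inv_closed[OF N(1)]
  have mem: "i \<otimes> x \<oplus> n \<in> ?S" if "i \<in> I" "n \<in> N" for i n using that by blast
  show ?thesis unfolding left_ideal_def
  proof (intro conjI additive_subgroup_of_closed ballI)
    show "?S \<subseteq> carrier R" using c assms by auto
    have "\<zero> \<otimes> x \<oplus> \<zero> \<in> ?S" by (intro mem additive_subgroup.zero_closed I N)
    then show "\<zero> \<in> ?S" using assms by simp
  next
    fix u v assume "u \<in> ?S" "v \<in> ?S"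
    then obtain i n j m where h: "i \<in> I" "n \<in> N" "j \<in> I" "m \<in> N" "u = i \<otimes> x \<oplus> n" "v = j \<otimes> x \<oplus> m"
      by auto
    then have "u \<oplus> v = (i \<oplus> j) \<otimes> x \<oplus> (n \<oplus> m)"
      using c assms by (simp add: l_distr a_ac)
    then show "u \<oplus> v \<in> ?S" using mem[OF cl(1,2)] h by simp
  next
    fix u assume "u \<in> ?S"
    then obtain i n where h: "i \<in> I" "n \<in> N" "u = i \<otimes> x \<oplus> n" by auto
    then have "\<ominus> u = (\<ominus> i) \<otimes> x \<oplus> (\<ominus> n)"
      using c assms by (simp add: l_minus minus_add)
    then show "\<ominus> u \<in> ?S" using mem[OF cl(3,4)] h by simp
  next
    fix u r assume r: "r \<in> carrier R" and "u \<in> ?S"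
    then obtain i n where h: "i \<in> I" "n \<in> N" "u = i \<otimes> x \<oplus> n" by auto
    then have "r \<otimes> u = (r \<otimes> i) \<otimes> x \<oplus> (r \<otimes> n)"
      using r c assms by (simp add: r_distr m_assoc)
    then show "r \<otimes> u \<in> ?S" using mem[OF I(2) N(2)] h r by simp
  qed
qed

lemma (in ring) left_ideal_carrier: "left_ideal (carrier R) R"
  unfolding left_ideal_def by (auto intro!: additive_subgroup_of_closed)

lemma (in ring) left_ideal_zero: "left_ideal {\<zero>} R"
  unfolding left_ideal_def by (auto intro!: additive_subgroup_of_closed)

lemma (in ring) left_ideal_one_imp_carrier:
  assumes "left_ideal I R" "\<one> \<in> I"
  shows "I = carrier R"
  using assms additive_subgroup.a_subset[of I R] r_one unfolding left_ideal_def by (metis subsetI subset_antisym)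

section \<open>The unique maximal left ideal: two-sidedness and nilpotency\<close>

locale finite_local_ring = ring R for R (structure) +
  fixes J
  assumes finite_carrier: "finite (carrier R)"
    and maximal: "maximal_left_ideal J R"
    and unique: "maximal_left_ideal M R \<Longrightarrow> M = J"
begin

lemma left_J: "left_ideal J R" and J_neq: "J \<noteq> carrier R"
  using maximal by (auto simp: maximal_left_ideal_def)

lemma J_add: "additive_subgroup J R"
  using left_J by (auto simp: left_ideal_def)

lemma J_carr: "x \<in> J \<Longrightarrow> x \<in> carrier R"
  by (rule additive_subgroup.a_Hcarr[OF J_add])

lemma one_notin_J: "\<one> \<notin> J"
  using left_ideal_one_imp_carrier left_J J_neq by blast

lemma proper_left_ideal_subset_J:
  assumes "left_ideal I R" "I \<noteq> carrier R"
  shows "I \<subseteq> J"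
  using proper_left_ideal_subset_maximal[OF finite_carrier assms] unique by auto

text \<open>\<open>R x\<close> is a left ideal containing \<open>x\<close>, so it does not lie in
  \<open>J\<close> and must be all of \<open>R\<close>.\<close>

lemma left_inverse_of_notin_J:
  assumes "x \<in> carrier R" "x \<notin> J"
  shows "\<exists>y\<in>carrier R. y \<otimes> x = \<one>"
proof -
  let ?I = "{i \<otimes> x \<oplus> n | i n. i \<in> carrier R \<and> n \<in> {\<zero>}}"
  have "left_ideal ?I R"
    by (rule left_ideal_principal_add[OF left_ideal_carrier left_ideal_zero assms(1)])
  moreover have "x = \<one> \<otimes> x \<oplus> \<zero>" using assms by simp
  then have "x \<in> ?I" by blast
  ultimately have "?I = carrier R" using proper_left_ideal_subset_J assms(2) by blast
  then have "\<one> \<in> ?I" by simp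
  then show ?thesis using assms by auto
qed

text \<open>If \<open>x r\<close> were outside \<open>J\<close>, some \<open>y\<close> would satisfy
  \<open>y x r = 1\<close>. In a finite ring one-sided inverses are two-sided, so
  \<open>r y x = 1\<close>, which puts \<open>1\<close> into the left ideal
  \<open>J\<close>.\<close>

lemma ideal_J: "ideal J R"
proof (rule idealI)
  show "ring R" by (rule ring_axioms)
  show "subgroup J (add_monoid R)" using J_add by (rule additive_subgroup.a_subgroup)
  fix x r assume xr: "x \<in> J" "r \<in> carrier R"
  show "r \<otimes> x \<in> J" using left_J xr by (auto simp: left_ideal_def)
  show "x \<otimes> r \<in> J"
  proof (rule ccontr)
    assume "x \<otimes> r \<notin> J"
    then obtain y where y: "y \<in> carrier R" "y \<otimes> (x \<otimes> r) = \<one>"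
      using left_inverse_of_notin_J[OF m_closed[OF J_carr]] xr by blast
    then have "(y \<otimes> x) \<otimes> r = \<one>" using xr J_carr by (simp add: m_assoc)
    then have "r \<otimes> (y \<otimes> x) = \<one>"
      using finite_left_inverse_imp_right_inverse[OF finite_carrier m_closed[OF y(1) J_carr]] xr
      by blast
    moreover have "r \<otimes> (y \<otimes> x) \<in> J" using left_J xr y by (auto simp: left_ideal_def)
    ultimately show False using one_notin_J by simp
  qed
qed

text \<open>For a maximal proper left subideal \<open>N\<close> of \<open>L\<close> and \<open>x \<in> L - N\<close>, the left ideal
  \<open>{r. r x \<in> N}\<close> is maximal, so it equals \<open>J\<close>; hence \<open>J L \<subseteq> N\<close>.\<close>

lemma nakayama:
  assumes L: "ideal L R" "L \<noteq> {\<zero>}"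
  shows "J \<cdot> L \<noteq> L"
proof -
  have Lsub: "L \<subseteq> carrier R" and Ladd: "additive_subgroup L R"
    using ideal.Icarr[OF L(1)] ideal.axioms(1)[OF L(1)] by auto
  let ?F = "{N. left_ideal N R \<and> N \<subset> L}"
  have "finite ?F"
    by (rule finite_subset[of _ "Pow (carrier R)"]) (use finite_carrier Lsub in auto)
  moreover have "{\<zero>} \<in> ?F"
    using L left_ideal_zero additive_subgroup.zero_closed[OF Ladd] by auto
  ultimately obtain N where N: "N \<in> ?F" "\<forall>L \<in> ?F. N \<subseteq> L \<longrightarrow> N = L"
    using finite_has_maximal[of ?F] by auto
  have Nl: "left_ideal N R" "N \<subset> L" using N by auto
  have Na: "additive_subgroup N R" "\<And>a r. a \<in> N \<Longrightarrow> r \<in> carrier R \<Longrightarrow> r \<otimes> a \<in> N"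
    using Nl by (auto simp: left_ideal_def)
  have jx: "j \<otimes> x \<in> N" if j: "j \<in> J" and x: "x \<in> L" for j x
  proof (cases "x \<in> N")
    case True
    then show ?thesis using Na j J_carr by blast
  next
    case False
    have xc: "x \<in> carrier R" using x Lsub by auto
    let ?M = "{r \<in> carrier R. r \<otimes> x \<in> N}"
    have Ml: "left_ideal ?M R" unfolding left_ideal_def
    proof (intro conjI additive_subgroup_of_closed ballI)
      show "\<zero> \<in> ?M" using xc additive_subgroup.zero_closed[OF Na(1)] by auto
    next
      fix u v assume "u \<in> ?M" "v \<in> ?M"
      then show "u \<oplus> v \<in> ?M" using xc additive_subgroup.a_closed[OF Na(1)] by (auto simp: l_distr)
    next
      fix u assume "u \<in> ?M"
      then show "\<ominus> u \<in> ?M"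
        using xc additive_subgroup.a_inv_closed[OF Na(1)] by (auto simp: l_minus)
    next
      fix u r assume "u \<in> ?M" "r \<in> carrier R"
      then show "r \<otimes> u \<in> ?M" using xc Na by (auto simp: m_assoc)
    qed auto
    have "maximal_left_ideal ?M R" unfolding maximal_left_ideal_def
    proof (intro conjI allI impI Ml)
      have "\<one> \<notin> ?M" using False xc by simp
      then show "?M \<noteq> carrier R" using one_closed by blast
      fix I assume I: "left_ideal I R \<and> ?M \<subseteq> I"
      show "I = ?M \<or> I = carrier R"
      proof (cases "I \<subseteq> ?M")
        case True
        then show ?thesis using I by blast
      next
        case nI: False
        have Isub: "I \<subseteq> carrier R" and Ia: "additive_subgroup I R"
          using I additive_subgroup.a_subset[of I R] by (auto simp: left_ideal_def)
        obtain i0 where i0: "i0 \<in> I" "i0 \<otimes> x \<notin> N" using nI Isub by auto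
        \<comment> \<open>\<open>I x + N\<close> lies in \<open>L\<close> and is strictly larger
          than \<open>N\<close>, so it equals \<open>L\<close> by the choice of \<open>N\<close>.
          Writing \<open>x = i x + n\<close> gives \<open>(1 - i) x \<in> N\<close>, so
          \<open>1 - i\<close> lies in \<open>?M\<close>, hence in \<open>I\<close>, and therefore
          \<open>1 \<in> I\<close>.\<close>
        let ?N = "{i \<otimes> x \<oplus> n | i n. i \<in> I \<and> n \<in> N}"
        have N': "left_ideal ?N R" by (rule left_ideal_principal_add) (use I Nl xc in auto)
        have "?N \<subseteq> L"
          using x Nl Isub by (auto intro!: additive_subgroup.a_closed[OF Ladd] ideal.I_l_closed[OF L(1)])
        moreover have "N \<subseteq> ?N"
        proof
          fix n assume "n \<in> N"
          moreover from this have "n = \<zero> \<otimes> x \<oplus> n"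
            using xc additive_subgroup.a_Hcarr[OF Na(1)] by simp
          ultimately show "n \<in> ?N" using additive_subgroup.zero_closed[OF Ia] by blast
        qed
        moreover have "i0 \<otimes> x \<in> ?N"
        proof -
          have "i0 \<otimes> x = i0 \<otimes> x \<oplus> \<zero>" using xc i0 Isub by auto
          then show ?thesis using i0 additive_subgroup.zero_closed[OF Na(1)] by blast
        qed
        ultimately have "?N = L" using bspec[OF N(2), of ?N] N' i0(2)
          by (smt (verit) mem_Collect_eq psubsetI)
        then obtain i n where i: "x = i \<otimes> x \<oplus> n" "i \<in> I" "n \<in> N" using x by blast
        have c: "i \<in> carrier R" "n \<in> carrier R" using i Isub additive_subgroup.a_Hcarr[OF Na(1)] by auto
        have "(\<one> \<ominus> i) \<otimes> x = x \<ominus> i \<otimes> x" using c xc by (simp add: l_distr a_minus_def l_minus)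
        also have "\<dots> = (i \<otimes> x \<oplus> n) \<ominus> i \<otimes> x" using i(1) by simp
        also have "\<dots> = n" using c xc by algebra
        finally have "\<one> \<ominus> i \<in> ?M" using i c by simp
        then have "(\<one> \<ominus> i) \<oplus> i \<in> I" using I i additive_subgroup.a_closed[OF Ia] by blast
        then have "\<one> \<in> I" using c by (simp add: a_minus_def a_assoc l_neg)
        then show ?thesis using left_ideal_one_imp_carrier I by blast
      qed
    qed
    then show ?thesis using unique j by blast
  qed
  have "y \<in> N" if "y \<in> J \<cdot> L" for y
    using that by induct (use jx additive_subgroup.a_closed[OF Na(1)] in auto)
  then show ?thesis using Nl by blast
qed

text \<open>The index is shifted: \<open>J_power m\<close> is the power \<open>J ^ (m + 1)\<close>.\<close>

primrec J_power :: "nat \<Rightarrow> 'a set" where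
  "J_power 0 = J"
| "J_power (Suc m) = J \<cdot> J_power m"

lemma ideal_J_power: "ideal (J_power m) R"
  by (induct m) (auto simp: ideal_J intro: ideal_prod_is_ideal)

text \<open>The recursion multiplies by \<open>J\<close> on the left; this also places products with
  the new factor on the right in the next power.\<close>

lemma J_power_commute: "J_power m \<cdot> J = J \<cdot> J_power m"
proof (induct m)
  case (Suc m)
  have "J_power (Suc m) \<cdot> J = J \<cdot> (J_power m \<cdot> J)"
    using ideal_prod_assoc[OF ideal_J ideal_J_power ideal_J] by simp
  then show ?case using Suc by simp
qed simp

text \<open>By Nakayama every nonzero power of \<open>J\<close> strictly contains the next one, and
  finite cardinals cannot decrease forever.\<close>

lemma J_power_eq_zero: "\<exists>m. J_power m = {\<zero>}"
proof (rule ccontr)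
  assume "\<not> ?thesis"
  then have "J_power (Suc m) \<subset> J_power m" for m
    using nakayama[OF ideal_J_power[of m]] ideal_prod_inter[OF ideal_J ideal_J_power[of m]]
    by (metis J_power.simps(2) le_inf_iff psubsetI)
  moreover have fin: "finite (J_power m)" for m
    using finite_carrier ideal.Icarr[OF ideal_J_power] by (meson finite_subset subsetI)
  ultimately have less: "card (J_power (Suc m)) < card (J_power m)" for m
    using psubset_card_mono by blast
  have "card (J_power m) + m \<le> card (J_power 0)" for m
  proof (induct m)
    case (Suc m)
    then show ?case using less[of m] by linarith
  qed simp
  from this[of "Suc (card (J_power 0))"] show False by linarith
qed

end

section \<open>Integer multiples and the residue field\<close>

lemma (in ring) int_mult_zero [simp]: "[(0 :: int)] \<cdot> x = \<zero>"
  by (simp add: add_pow_def)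

lemma (in ring) add_minus_cancel:
  "x \<in> carrier R \<Longrightarrow> y \<in> carrier R \<Longrightarrow> (x \<oplus> y) \<oplus> \<ominus> x = y"
  by (simp add: a_comm[of x y] a_assoc r_neg)

lemma (in ring) int_mult_add:
  "x \<in> carrier R \<Longrightarrow> [(i + j :: int)] \<cdot> x = [i] \<cdot> x \<oplus> [j] \<cdot> x"
  by (rule add.int_pow_mult)

lemma (in ring) int_mult_uminus:
  "x \<in> carrier R \<Longrightarrow> [(- i :: int)] \<cdot> x = \<ominus> ([i] \<cdot> x)"
  by (rule add.int_pow_neg)

lemma (in ring) int_mult_distrib:
  "x \<in> carrier R \<Longrightarrow> y \<in> carrier R \<Longrightarrow> [(i :: int)] \<cdot> (x \<oplus> y) = [i] \<cdot> x \<oplus> [i] \<cdot> y"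
  by (rule add.int_pow_distrib)

lemma (in ring) int_mult_assoc:
  "x \<in> carrier R \<Longrightarrow> [(i :: int)] \<cdot> ([(j :: int)] \<cdot> x) = [(i * j)] \<cdot> x"
  using add.int_pow_pow[of x i j] by (simp add: mult.commute)

lemma (in ring) int_mult_one_l:
  "x \<in> carrier R \<Longrightarrow> ([(i :: int)] \<cdot> \<one>) \<otimes> x = [i] \<cdot> x"
  by (simp add: add_pow_ldistr_int)

lemma (in ring) int_mult_one_r:
  "x \<in> carrier R \<Longrightarrow> x \<otimes> ([(i :: int)] \<cdot> \<one>) = [i] \<cdot> x"
  by (simp add: add_pow_rdistr_int)

lemma ring_hom_int_mult:
  fixes k :: int
  assumes "ring R" "ring S" "h \<in> ring_hom R S" "x \<in> carrier R"
  shows "h ([k] \<cdot>\<^bsub>R\<^esub> x) = [k] \<cdot>\<^bsub>S\<^esub> h x"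
proof -
  interpret ring_hom_ring R S h by (rule ring_hom_ringI2) (use assms in auto)
  show ?thesis
    using group_hom.hom_int_pow[OF a_group_hom, of x k] assms by (simp add: add_pow_def)
qed

lemma residue_ring_int_mult_one:
  fixes k m :: int
  assumes "1 < m"
  shows "[k] \<cdot>\<^bsub>residue_ring m\<^esub> \<one>\<^bsub>residue_ring m\<^esub> = k mod m"
proof -
  interpret residues m "residue_ring m" by unfold_locales (use assms in auto)
  show ?thesis
  proof (induct k rule: int_induct[of _ 0])
    case base
    then show ?case using assms by (simp add: res_zero_eq)
  next
    case (step1 i)
    then show ?case using assms
      by (simp only: int_mult_add add.int_pow_1 one_closed) (simp add: res_add_eq res_one_eq mod_simps)
  next
    case (step2 i)
    have "[(i - 1)] \<cdot>\<^bsub>residue_ring m\<^esub> \<one>\<^bsub>residue_ring m\<^esub> =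
        [(i + (- 1))] \<cdot>\<^bsub>residue_ring m\<^esub> \<one>\<^bsub>residue_ring m\<^esub>" by simp
    also have "\<dots> = (i - 1) mod m"
      using step2 assms
      by (simp only: int_mult_add int_mult_uminus add.int_pow_1 one_closed)
        (simp add: res_add_eq res_one_eq res_neg_eq mod_simps)
    finally show ?case .
  qed
qed

text \<open>Let \<open>?g\<close> be reduction modulo \<open>J\<close> followed by the isomorphism
  onto \<open>F_p\<close>. It sends the multiple \<open>k\<close> of \<open>1\<close> to
  \<open>k mod p\<close>, and elements with equal image differ by an element of
  \<open>J\<close>.\<close>

lemma (in finite_local_ring) residue_field_decomposition:
  fixes p :: nat
  assumes iso: "R Quot J \<simeq> residue_ring (int p)" and p: "Factorial_Ring.prime p"
  shows "[int p] \<cdot> \<one> \<in> J" and "r \<in> carrier R \<Longrightarrow> \<exists>k :: int. r \<ominus> [k] \<cdot> \<one> \<in> J"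
proof -
  interpret J: ideal J R by (rule ideal_J)
  have p1: "1 < int p" using p prime_gt_1_nat by auto
  interpret K: residues "int p" "residue_ring (int p)" by unfold_locales (use p1 in auto)
  obtain f where f: "f \<in> ring_iso (R Quot J) (residue_ring (int p))"
    using iso by (auto simp: is_ring_iso_def)
  let ?g = "f \<circ> (+>) J"
  have g: "?g \<in> ring_hom R (residue_ring (int p))"
    using f by (intro ring_hom_trans[OF J.rcos_ring_hom]) (auto simp: ring_iso_def)
  have gk: "?g ([k] \<cdot> \<one>) = k mod int p" for k :: int
    using ring_hom_int_mult[OF ring_axioms K.ring_axioms g, of \<one> k] ring_hom_one[OF g]
      residue_ring_int_mult_one[OF p1, of k] by simp
  have eqD: "r \<ominus> s \<in> J" if "?g r = ?g s" "r \<in> carrier R" "s \<in> carrier R" for r s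
  proof -
    have "J +> r = J +> s"
      using f that by (auto simp: ring_iso_def bij_betw_def FactRing_simps dest!: inj_onD)
    then show ?thesis using quotient_eq_iff_same_a_r_cos[OF ideal_J] that by simp
  qed
  have "?g ([int p] \<cdot> \<one>) = ?g ([(0 :: int)] \<cdot> \<one>)" by (simp only: gk) simp
  then have "[int p] \<cdot> \<one> \<ominus> [(0 :: int)] \<cdot> \<one> \<in> J" by (rule eqD) auto
  then show "[int p] \<cdot> \<one> \<in> J" by (simp add: a_minus_def)
  show "\<exists>k :: int. r \<ominus> [k] \<cdot> \<one> \<in> J" if r: "r \<in> carrier R"
  proof -
    have "?g r \<in> carrier (residue_ring (int p))" using ring_hom_closed[OF g r] .
    \<comment> \<open>Elements of \<open>residue_ring\<close> are themselves integers, so the value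
      \<open>?g r\<close> serves as the multiplier \<open>k\<close>.\<close>
    then have "?g r mod int p = ?g r" by (simp add: K.res_carrier_eq)
    then have "?g ([?g r] \<cdot> \<one>) = ?g r" by (simp only: gk)
    then have "r \<ominus> [?g r] \<cdot> \<one> \<in> J" using r by (intro eqD) auto
    then show ?thesis by blast
  qed
qed

section \<open>Additive groups above \<open>J^2 + p R\<close>\<close>

text \<open>The isomorphism of \<open>R/J\<close> with \<open>F_p\<close> enters only through
  \<open>p_in_J\<close> and \<open>decomposition\<close>: \<open>p\<close> vanishes in
  \<open>R/J\<close>, and the integers map onto \<open>R/J\<close>.\<close>

locale finite_local_prime_ring = finite_local_ring +
  fixes p :: nat
  assumes prime: "Factorial_Ring.prime p"
    and p_in_J: "[int p] \<cdot> \<one> \<in> J"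
    and decomposition: "r \<in> carrier R \<Longrightarrow> \<exists>k :: int. r \<ominus> [k] \<cdot> \<one> \<in> J"
begin

text \<open>Asking for \<open>p 1\<close> already yields \<open>p R\<close>, since
  \<open>R = \<int> + J\<close> and \<open>p u = (p 1) u\<close> is a product of two elements of
  \<open>J\<close> for \<open>u \<in> J\<close>. Containment in \<open>J\<close> is kept apart, so
  that \<open>Phi_subset\<close> also applies to subgroups containing \<open>1\<close>.\<close>

definition above_Phi :: "'a set \<Rightarrow> bool"
  where "above_Phi K \<longleftrightarrow>
    additive_subgroup K R \<and> [int p] \<cdot> \<one> \<in> K \<and> (\<forall>x\<in>J. \<forall>y\<in>J. x \<otimes> y \<in> K)"

text \<open>Explicitly this is \<open>J\<^sup>2 + p R\<close>, the analogue of a Frattini subgroup.\<close>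

definition Phi :: "'a set"
  where "Phi = \<Inter>{K. above_Phi K}"

text \<open>When \<open>Phi \<subseteq> K \<subseteq> J\<close> and \<open>c \<in> J\<close>, this
  is modulo \<open>Phi\<close> the \<open>F_p\<close>-subspace spanned by \<open>K\<close> and
  \<open>c\<close>.\<close>

definition adjoin :: "'a set \<Rightarrow> 'a \<Rightarrow> 'a set"
  where "adjoin K c = {k \<oplus> [m] \<cdot> c | k (m :: int). k \<in> K}"

lemma above_Phi_J: "above_Phi J"
  unfolding above_Phi_def
  using J_add p_in_J ideal.I_l_closed[OF ideal_J] J_carr by blast

lemma above_PhiD:
  assumes "above_Phi K"
  shows "additive_subgroup K R" "[int p] \<cdot> \<one> \<in> K" "\<And>x y. x \<in> J \<Longrightarrow> y \<in> J \<Longrightarrow> x \<otimes> y \<in> K"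
  using assms by (auto simp: above_Phi_def)

text \<open>Since \<open>p 1 \<in> J\<close>, the element \<open>p c = (p 1) c\<close> is a product
  of two elements of \<open>J\<close>.\<close>

lemma above_Phi_mult_p:
  assumes "above_Phi K" "c \<in> J" "int p dvd k"
  shows "[k] \<cdot> c \<in> K"
proof -
  obtain l where l: "k = l * int p" using assms by (metis dvd_def mult.commute)
  have c: "c \<in> carrier R" using assms J_carr by blast
  have "[int p] \<cdot> \<one> \<otimes> c \<in> K" using above_PhiD(3)[OF assms(1) p_in_J] assms by blast
  then have "[int p] \<cdot> c \<in> K" using c by (simp add: int_mult_one_l)
  then have "[l] \<cdot> ([int p] \<cdot> c) \<in> K"
    by (rule additive_subgroup_int_mult_closed[OF above_PhiD(1)[OF assms(1)]])
  then show ?thesis using c l by (simp add: int_mult_assoc)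
qed

text \<open>Scalars prime to \<open>p\<close> are invertible modulo \<open>K\<close>: with
  \<open>u l + v p = 1\<close>, the element \<open>c\<close> is the sum of \<open>u (l c)\<close>
  and \<open>(v p) c\<close>, both in \<open>K\<close>.\<close>

lemma above_Phi_coprime_mult:
  assumes K: "above_Phi K" and c: "c \<in> J" and lc: "[l] \<cdot> c \<in> K" and l: "\<not> int p dvd l"
  shows "c \<in> K"
proof -
  have "coprime (int p) l" using l prime by (intro prime_imp_coprime) auto
  then obtain u v where uv: "u * l + v * int p = 1"
    using bezout_int[of l "int p"] by (metis coprime_iff_gcd_eq_1 gcd.commute)
  have cc: "c \<in> carrier R" using c J_carr by blast
  have "[u] \<cdot> ([l] \<cdot> c) \<oplus> [(v * int p)] \<cdot> c \<in> K"
    using additive_subgroup.a_closed[OF above_PhiD(1)[OF K]]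
      additive_subgroup_int_mult_closed[OF above_PhiD(1)[OF K] lc] above_Phi_mult_p[OF K c, of "v * int p"]
    by simp
  moreover have "[u] \<cdot> ([l] \<cdot> c) \<oplus> [(v * int p)] \<cdot> c = [(u * l + v * int p)] \<cdot> c"
    using cc by (simp add: int_mult_assoc int_mult_add)
  ultimately show ?thesis using uv cc by simp
qed

lemma above_Phi_Phi: "above_Phi Phi"
proof -
  have "additive_subgroup Phi R"
  proof (rule additive_subgroup_of_closed)
    show "Phi \<subseteq> carrier R" using above_Phi_J J_carr unfolding Phi_def by blast
    show "\<zero> \<in> Phi"
      unfolding Phi_def using above_PhiD(1) additive_subgroup.zero_closed by fastforce
    show "x \<oplus> y \<in> Phi" if "x \<in> Phi" "y \<in> Phi" for x y
      using that above_PhiD(1) unfolding Phi_def by (auto intro!: additive_subgroup.a_closed)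
    show "\<ominus> x \<in> Phi" if "x \<in> Phi" for x
      using that above_PhiD(1) unfolding Phi_def by (auto intro!: additive_subgroup.a_inv_closed)
  qed
  then show ?thesis unfolding above_Phi_def Phi_def by blast
qed

lemma Phi_subset: "above_Phi K \<Longrightarrow> Phi \<subseteq> K"
  unfolding Phi_def by blast

lemma adjoinI: "k \<in> K \<Longrightarrow> k \<oplus> [(m :: int)] \<cdot> c \<in> adjoin K c"
  unfolding adjoin_def by blast

lemma adjoin_additive_subgroup:
  assumes K: "additive_subgroup K R" and c: "c \<in> carrier R"
  shows "additive_subgroup (adjoin K c) R"
proof (rule additive_subgroup_of_closed)
  note Kc = additive_subgroup.a_Hcarr[OF K]
  show "adjoin K c \<subseteq> carrier R" using Kc c by (auto simp: adjoin_def)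
  show "\<zero> \<in> adjoin K c"
    using adjoinI[OF additive_subgroup.zero_closed[OF K], of 0 c] by simp
  show "x \<oplus> y \<in> adjoin K c" if xy: "x \<in> adjoin K c" "y \<in> adjoin K c" for x y
  proof -
    obtain k l and m n :: int
      where h: "k \<in> K" "l \<in> K" "x = k \<oplus> [m] \<cdot> c" "y = l \<oplus> [n] \<cdot> c"
      using xy by (auto simp: adjoin_def)
    then have "x \<oplus> y = (k \<oplus> l) \<oplus> [(m + n)] \<cdot> c"
      using Kc c by (simp add: int_mult_add a_ac)
    then show ?thesis using h adjoinI additive_subgroup.a_closed[OF K] by simp
  qed
  show "\<ominus> x \<in> adjoin K c" if x: "x \<in> adjoin K c" for x
  proof -
    obtain k and m :: int where h: "k \<in> K" "x = k \<oplus> [m] \<cdot> c"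
      using x by (auto simp: adjoin_def)
    then have "\<ominus> x = \<ominus> k \<oplus> [(- m)] \<cdot> c"
      using Kc c by (simp add: int_mult_uminus minus_add)
    then show ?thesis using h adjoinI additive_subgroup.a_inv_closed[OF K] by simp
  qed
qed

lemma subset_adjoin:
  assumes K: "additive_subgroup K R" and c: "c \<in> carrier R"
  shows "K \<subseteq> adjoin K c"
proof
  fix x assume "x \<in> K"
  then show "x \<in> adjoin K c"
    using adjoinI[of x K 0 c] additive_subgroup.a_Hcarr[OF K] by simp
qed

lemma self_in_adjoin:
  assumes K: "additive_subgroup K R" and c: "c \<in> carrier R"
  shows "c \<in> adjoin K c"
  using adjoinI[OF additive_subgroup.zero_closed[OF K], of 1 c] c by simp

lemma above_Phi_adjoin:
  assumes K: "above_Phi K" and c: "c \<in> carrier R"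
  shows "above_Phi (adjoin K c)"
  unfolding above_Phi_def
  using adjoin_additive_subgroup[OF above_PhiD(1)[OF K] c] subset_adjoin[OF above_PhiD(1)[OF K] c]
    above_PhiD[OF K] by blast

text \<open>Induction on the exponent shows \<open>J \<subseteq> T + J^(m+1)\<close>, the set
  \<open>?S m\<close>. In the step, products of elements of \<open>J\<close> fall into
  \<open>T + J^(m+2)\<close>, so this group is above \<open>Phi\<close>; it also contains
  \<open>a\<close>, hence \<open>Phi + \<int> a\<close> and \<open>J\<close>. Nilpotency then gives
  \<open>J \<subseteq> T\<close>, and \<open>R = \<int> + J\<close> gives
  \<open>R \<subseteq> T\<close>.\<close>

lemma subring_eq_carrier:
  assumes T: "additive_subgroup T R" "\<one> \<in> T" "\<And>x y. x \<in> T \<Longrightarrow> y \<in> T \<Longrightarrow> x \<otimes> y \<in> T"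
    and a: "a \<in> T" and cyclic: "J \<subseteq> adjoin Phi a"
  shows "T = carrier R"
proof -
  note Tc = additive_subgroup.a_Hcarr[OF T(1)]
  let ?S = "\<lambda>m. {t \<oplus> l | t l. t \<in> T \<and> l \<in> J_power m}"
  have Jp: "additive_subgroup (J_power m) R" for m using ideal.axioms(1)[OF ideal_J_power] .
  have Jpc: "x \<in> carrier R" if "x \<in> J_power m" for x m
    using that by (rule additive_subgroup.a_Hcarr[OF Jp])
  have JpJ: "x \<in> J" if "x \<in> J_power m" for x m
    using that ideal_prod_inter[OF ideal_J ideal_J_power] by (cases m) auto
  have S: "additive_subgroup (?S m) R" for m
  proof (rule additive_subgroup_of_closed)
    show "?S m \<subseteq> carrier R" using Tc Jpc by auto
    have "\<zero> \<oplus> \<zero> \<in> ?S m"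
      using additive_subgroup.zero_closed[OF T(1)] additive_subgroup.zero_closed[OF Jp] by blast
    then show "\<zero> \<in> ?S m" by simp
    fix x assume "x \<in> ?S m"
    then obtain t l where x: "x = t \<oplus> l" "t \<in> T" "l \<in> J_power m" by auto
    then have "\<ominus> x = \<ominus> t \<oplus> \<ominus> l" using Tc Jpc by (simp add: minus_add)
    then show "\<ominus> x \<in> ?S m"
      using x additive_subgroup.a_inv_closed[OF T(1)] additive_subgroup.a_inv_closed[OF Jp] by blast
    fix y assume "y \<in> ?S m"
    then obtain u k where y: "y = u \<oplus> k" "u \<in> T" "k \<in> J_power m" by auto
    have "x \<oplus> y = (t \<oplus> u) \<oplus> (l \<oplus> k)"
      using x y Tc Jpc by (simp add: a_ac)
    then show "x \<oplus> y \<in> ?S m"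
      using x y additive_subgroup.a_closed[OF T(1)] additive_subgroup.a_closed[OF Jp] by blast
  qed
  have TS: "t \<in> ?S m" if "t \<in> T" for t m
  proof -
    have "t = t \<oplus> \<zero>" using that Tc by simp
    then show ?thesis using that additive_subgroup.zero_closed[OF Jp] by blast
  qed
  have JS: "J \<subseteq> ?S m" for m
  proof (induct m)
    case 0
    show ?case
    proof
      fix x assume x: "x \<in> J"
      then have "x = \<zero> \<oplus> x" using J_carr by simp
      then show "x \<in> ?S 0" using x additive_subgroup.zero_closed[OF T(1)] by auto
    qed
  next
    case (Suc m)
    have "x \<otimes> y \<in> ?S (Suc m)" if xy: "x \<in> J" "y \<in> J" for x y
    proof -
      obtain t l where x: "x = t \<oplus> l" "t \<in> T" "l \<in> J_power m" using Suc xy by blast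
      obtain u k where y: "y = u \<oplus> k" "u \<in> T" "k \<in> J_power m" using Suc xy by blast
      note c = Tc[OF x(2)] Tc[OF y(2)] Jpc[OF x(3)] Jpc[OF y(3)] J_carr[OF xy(1)] J_carr[OF xy(2)]
      \<comment> \<open>Knowing \<open>t \<in> J\<close>, and not merely \<open>t \<in> T\<close>,
        is what moves \<open>t k\<close> into the next power of \<open>J\<close>.\<close>
      have "t = x \<ominus> l" using x c by (simp add: a_minus_def a_assoc r_neg)
      then have tJ: "t \<in> J"
        using additive_subgroup_minus_closed[OF J_add] xy JpJ x by blast
      have "x \<otimes> y = t \<otimes> y \<oplus> l \<otimes> y" using c x by (simp add: l_distr)
      also have "t \<otimes> y = t \<otimes> u \<oplus> t \<otimes> k" using c y by (simp add: r_distr)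
      finally have "x \<otimes> y = t \<otimes> u \<oplus> (t \<otimes> k \<oplus> l \<otimes> y)" using c by (simp add: a_assoc)
      moreover have "t \<otimes> k \<in> J_power (Suc m)"
        using ideal_prod.prod[OF tJ y(3)] by simp
      moreover have "l \<otimes> y \<in> J_power (Suc m)"
        using ideal_prod.prod[OF x(3) xy(2), of R] J_power_commute by simp
      ultimately show ?thesis
        using T(3)[OF x(2) y(2)] additive_subgroup.a_closed[OF Jp] by blast
    qed
    moreover have "[int p] \<cdot> \<one> \<in> T" using additive_subgroup_int_mult_closed T(1,2) by blast
    ultimately have "above_Phi (?S (Suc m))" unfolding above_Phi_def using S TS by blast
    then have Phi: "Phi \<subseteq> ?S (Suc m)" by (rule Phi_subset)
    show ?case
    proof
      fix x assume "x \<in> J"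
      then obtain k and n :: int where k: "x = k \<oplus> [n] \<cdot> a" "k \<in> Phi"
        using cyclic by (auto simp: adjoin_def)
      show "x \<in> ?S (Suc m)" unfolding k(1)
        using Phi k(2) additive_subgroup_int_mult_closed[OF S TS[OF a]]
        by (intro additive_subgroup.a_closed[OF S]) blast+
    qed
  qed
  obtain m where "J_power m = {\<zero>}" using J_power_eq_zero by blast
  then have "?S m \<subseteq> T" using Tc by auto
  then have JT: "J \<subseteq> T" using JS by blast
  have "r \<in> T" if r: "r \<in> carrier R" for r
  proof -
    obtain k :: int where k: "r \<ominus> [k] \<cdot> \<one> \<in> J" using decomposition r by blast
    have "(r \<ominus> [k] \<cdot> \<one>) \<oplus> [k] \<cdot> \<one> \<in> T"
      using k JT additive_subgroup_int_mult_closed[OF T(1,2)]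
      by (intro additive_subgroup.a_closed[OF T(1)]) auto
    then show ?thesis using r by (simp add: a_minus_def a_assoc l_neg)
  qed
  then show ?thesis using Tc by blast
qed

text \<open>Centralizers are subrings containing \<open>1\<close>. The centralizer of
  \<open>a\<close> contains \<open>a\<close>, so it is \<open>R\<close> by
  \<open>subring_eq_carrier\<close>; thus \<open>a\<close> is central, and the same argument applied
  to the centre makes it all of \<open>R\<close>.\<close>

lemma cyclic_imp_cring:
  assumes a: "a \<in> J" and cyclic: "J \<subseteq> adjoin Phi a"
  shows "cring R"
proof -
  let ?C = "\<lambda>S. {x \<in> carrier R. \<forall>s\<in>S. x \<otimes> s = s \<otimes> x}"
  have C: "?C S = carrier R" if S: "S \<subseteq> carrier R" and aS: "a \<in> ?C S" for S
  proof (rule subring_eq_carrier[OF _ _ _ aS cyclic])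
    show "additive_subgroup (?C S) R"
    proof (rule additive_subgroup_of_closed)
      show "\<ominus> x \<in> ?C S" if "x \<in> ?C S" for x
        using that S by (auto simp: l_minus r_minus subset_iff)
      show "x \<oplus> y \<in> ?C S" if "x \<in> ?C S" "y \<in> ?C S" for x y
        using that S by (auto simp: l_distr r_distr subset_iff)
    qed (use S in \<open>auto simp: subset_iff\<close>)
    show "\<one> \<in> ?C S" using S by (auto simp: subset_iff)
    fix x y assume xy: "x \<in> ?C S" "y \<in> ?C S"
    have "x \<otimes> y \<otimes> s = s \<otimes> (x \<otimes> y)" if s: "s \<in> S" for s
    proof -
      have sc: "s \<in> carrier R" using s S by blast
      have "x \<otimes> y \<otimes> s = x \<otimes> (s \<otimes> y)" using xy s sc by (simp add: m_assoc)
      also have "\<dots> = (x \<otimes> s) \<otimes> y" using xy sc by (simp add: m_assoc)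
      also have "\<dots> = s \<otimes> (x \<otimes> y)" using xy s sc by (simp add: m_assoc)
      finally show ?thesis .
    qed
    then show "x \<otimes> y \<in> ?C S" using xy by simp
  qed
  have ac: "a \<in> carrier R" using a J_carr by blast
  have "?C {a} = carrier R" using C[of "{a}"] ac by simp
  then have "x \<otimes> a = a \<otimes> x" if "x \<in> carrier R" for x using that by blast
  then have "a \<in> ?C (carrier R)" using ac by simp
  then have "?C (carrier R) = carrier R" using C[of "carrier R"] by simp
  then have "x \<otimes> y = y \<otimes> x" if "x \<in> carrier R" "y \<in> carrier R" for x y using that by blast
  then show ?thesis by unfold_locales auto
qed

text \<open>Linear independence over \<open>F_p\<close> of the classes of \<open>a\<close> and
  \<open>b\<close> modulo \<open>K\<close>, with integers representing the scalars.\<close>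

definition independent :: "'a set \<Rightarrow> 'a \<Rightarrow> 'a \<Rightarrow> bool"
  where "independent K a b \<longleftrightarrow>
    (\<forall>i j :: int. [i] \<cdot> a \<oplus> [j] \<cdot> b \<in> K \<longrightarrow> int p dvd i \<and> int p dvd j)"

text \<open>Noncommutativity provides \<open>a\<close>, \<open>b\<close> independent modulo
  \<open>Phi\<close>. A subgroup \<open>K\<close> maximal among those that keep them independent is
  a complement of their span in \<open>J\<close> modulo \<open>Phi\<close>, so \<open>a\<close>,
  \<open>b\<close> is a basis of \<open>J/K\<close>.\<close>

lemma above_Phi_with_basis:
  assumes "\<not> cring R"
  obtains K a b where "above_Phi K" "K \<subseteq> J" "a \<in> J" "b \<in> J" "independent K a b"
    "J \<subseteq> adjoin (adjoin K a) b"
proof -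
  have Phi_add: "additive_subgroup Phi R" using above_PhiD(1)[OF above_Phi_Phi] .
  have nc: "\<exists>x\<in>J. x \<notin> adjoin Phi c" if "c \<in> J" for c
    using cyclic_imp_cring[OF that] assms by blast
  \<comment> \<open>Taking \<open>c = 0\<close> reduces \<open>adjoin Phi c\<close> to
    \<open>Phi\<close>, so \<open>a\<close> is simply an element of \<open>J\<close> outside
    \<open>Phi\<close>.\<close>
  obtain a where a: "a \<in> J" "a \<notin> adjoin Phi \<zero>"
    using nc[of \<zero>] additive_subgroup.zero_closed[OF J_add] by blast
  obtain b where b: "b \<in> J" "b \<notin> adjoin Phi a" using nc[OF a(1)] by blast
  note abc = J_carr[OF a(1)] J_carr[OF b(1)]
  have a': "a \<notin> Phi" using a(2) subset_adjoin[OF Phi_add, of \<zero>] by auto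
  have "independent Phi a b" unfolding independent_def
  proof (intro allI impI)
    fix i j :: int assume ij: "[i] \<cdot> a \<oplus> [j] \<cdot> b \<in> Phi"
    have "[j] \<cdot> b = ([i] \<cdot> a \<oplus> [j] \<cdot> b) \<oplus> [(- i)] \<cdot> a"
      using abc by (simp add: int_mult_uminus add_minus_cancel)
    then have "[j] \<cdot> b \<in> adjoin Phi a" using adjoinI[OF ij] by metis
    then have j: "int p dvd j"
      using above_Phi_coprime_mult[OF above_Phi_adjoin[OF above_Phi_Phi abc(1)] b(1)] b(2) by blast
    have "([i] \<cdot> a \<oplus> [j] \<cdot> b) \<ominus> [j] \<cdot> b \<in> Phi"
      using ij above_Phi_mult_p[OF above_Phi_Phi b(1) j]
      by (rule additive_subgroup_minus_closed[OF Phi_add])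
    then have "[i] \<cdot> a \<in> Phi" using abc by (simp add: a_minus_def a_assoc r_neg)
    then have "int p dvd i" using above_Phi_coprime_mult[OF above_Phi_Phi a(1)] a' by blast
    with j show "int p dvd i \<and> int p dvd j" by blast
  qed
  let ?F = "{K. above_Phi K \<and> K \<subseteq> J \<and> independent K a b}"
  have "finite ?F"
    by (rule finite_subset[of _ "Pow (carrier R)"]) (use finite_carrier J_carr in auto)
  moreover have "Phi \<in> ?F"
    using above_Phi_Phi Phi_subset[OF above_Phi_J] \<open>independent Phi a b\<close> by blast
  ultimately obtain K where "K \<in> ?F" and max: "\<And>L. L \<in> ?F \<Longrightarrow> K \<subseteq> L \<Longrightarrow> K = L"
    using finite_has_maximal[of ?F] by (metis (no_types, lifting) empty_iff)
  then have K: "above_Phi K" "K \<subseteq> J" "independent K a b" by auto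
  note Ka = above_PhiD(1)[OF K(1)]
  let ?V = "adjoin (adjoin K a) b"
  have V: "above_Phi ?V" "K \<subseteq> ?V"
    using above_Phi_adjoin[OF above_Phi_adjoin[OF K(1) abc(1)] abc(2)] subset_adjoin[OF Ka abc(1)]
      subset_adjoin[OF adjoin_additive_subgroup[OF Ka abc(1)] abc(2)] by auto
  have "c \<in> ?V" if c: "c \<in> J" for c
  proof (rule ccontr)
    assume nV: "c \<notin> ?V"
    have cc: "c \<in> carrier R" using c J_carr by blast
    \<comment> \<open>A relation modulo \<open>K + \<int> c\<close> puts some \<open>l c\<close>
      into \<open>?V\<close>. As \<open>c \<notin> ?V\<close>, \<open>p\<close> divides
      \<open>l\<close>, so \<open>l c \<in> K\<close> and the relation already holds modulo
      \<open>K\<close>. Adjoining \<open>c\<close> thus contradicts maximality.\<close>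
    have "independent (adjoin K c) a b" unfolding independent_def
    proof (intro allI impI)
      fix i j :: int assume "[i] \<cdot> a \<oplus> [j] \<cdot> b \<in> adjoin K c"
      then obtain k and l :: int where k: "k \<in> K" "[i] \<cdot> a \<oplus> [j] \<cdot> b = k \<oplus> [l] \<cdot> c"
        by (auto simp: adjoin_def)
      have kc: "k \<in> carrier R" using k Ka additive_subgroup.a_Hcarr by fast
      have "[l] \<cdot> c = (k \<oplus> [l] \<cdot> c) \<oplus> \<ominus> k" using kc cc by (simp add: add_minus_cancel)
      also have "\<dots> = (\<ominus> k \<oplus> [i] \<cdot> a) \<oplus> [j] \<cdot> b"
        unfolding k(2)[symmetric] using kc abc by (simp add: a_ac)
      also have "\<dots> \<in> ?V"
        using additive_subgroup.a_inv_closed[OF Ka k(1)] by (intro adjoinI)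
      finally have "[l] \<cdot> c \<in> ?V" .
      then have "int p dvd l" using above_Phi_coprime_mult[OF V(1) c] nV by blast
      then have "[i] \<cdot> a \<oplus> [j] \<cdot> b \<in> K" unfolding k(2)
        using additive_subgroup.a_closed[OF Ka k(1)] above_Phi_mult_p[OF K(1) c] by blast
      then show "int p dvd i \<and> int p dvd j" using K(3) by (auto simp: independent_def)
    qed
    moreover have "adjoin K c \<subseteq> J"
      unfolding adjoin_def
      using K(2) additive_subgroup_int_mult_closed[OF J_add c] additive_subgroup.a_closed[OF J_add]
      by blast
    ultimately have "K = adjoin K c"
      using max above_Phi_adjoin[OF K(1) cc] subset_adjoin[OF Ka cc] by blast
    then show False using self_in_adjoin[OF Ka cc] V(2) nV by blast
  qed
  then show ?thesis using that K a(1) b(1) by blast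
qed

end

section \<open>Coordinates modulo a square-zero quotient\<close>

text \<open>Integer coefficients make the expression meaningful in every ring and compatible with
  every homomorphism, without an \<open>F_p\<close>-algebra structure.\<close>

definition (in ring) lin_comb :: "'a \<Rightarrow> 'a \<Rightarrow> int \<Rightarrow> int \<Rightarrow> int \<Rightarrow> 'a"
  where "lin_comb X Y n i j = [n] \<cdot> \<one> \<oplus> [i] \<cdot> X \<oplus> [j] \<cdot> Y"

context ring
begin

lemma lin_comb_closed [simp]:
  "X \<in> carrier R \<Longrightarrow> Y \<in> carrier R \<Longrightarrow> lin_comb X Y n i j \<in> carrier R"
  by (simp add: lin_comb_def)

lemma lin_comb_add:
  assumes "X \<in> carrier R" "Y \<in> carrier R"
  shows "lin_comb X Y n i j \<oplus> lin_comb X Y n' i' j' = lin_comb X Y (n + n') (i + i') (j + j')"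
  using assms by (simp add: lin_comb_def int_mult_add a_ac)

lemma lin_comb_diff:
  assumes "X \<in> carrier R" "Y \<in> carrier R"
  shows "lin_comb X Y n i j \<ominus> lin_comb X Y n' i' j' = lin_comb X Y (n - n') (i - i') (j - j')"
proof -
  have "lin_comb X Y n' i' j' \<oplus> lin_comb X Y (n - n') (i - i') (j - j') = lin_comb X Y n i j"
    using assms by (simp add: lin_comb_add)
  then show ?thesis
    using assms add_minus_cancel[of "lin_comb X Y n' i' j'" "lin_comb X Y (n - n') (i - i') (j - j')"]
    by (simp add: minus_eq)
qed

text \<open>This is the multiplication rule of \<open>F_p[x,y]/(x^2, xy, y^2)\<close> in the basis
  \<open>1, x, y\<close>; the axioms \<open>n_mult\<close> and \<open>leibniz\<close> below record
  it coordinatewise.\<close>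

lemma lin_comb_mult:
  assumes "X \<in> carrier R" "Y \<in> carrier R"
    and "X \<otimes> X = \<zero>" "X \<otimes> Y = \<zero>" "Y \<otimes> X = \<zero>" "Y \<otimes> Y = \<zero>"
  shows "lin_comb X Y n i j \<otimes> lin_comb X Y n' i' j' =
    lin_comb X Y (n * n') (n * i' + i * n') (n * j' + j * n')"
  using assms
  by (simp add: lin_comb_def int_mult_add l_distr r_distr add_pow_ldistr_int add_pow_rdistr_int
      int_mult_assoc int_mult_distrib a_ac add.int_pow_one mult.commute)

lemma int_mult_cong:
  assumes p: "[int p] \<cdot> \<one> = \<zero>" and kl: "[k = l] (mod int p)" and x: "x \<in> carrier R"
  shows "[k] \<cdot> x = [l] \<cdot> x"
proof -
  obtain m where m: "k = m * int p + l"
    using kl by (metis cong_iff_lin add.commute mult.commute cong_sym)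
  have "[int p] \<cdot> x = \<zero>" using int_mult_one_l[OF x, of "int p"] p x by simp
  then show ?thesis
    using x by (simp add: m int_mult_add int_mult_assoc[symmetric] add.int_pow_one)
qed

lemma lin_comb_cong:
  assumes "[int p] \<cdot> \<one> = \<zero>" "X \<in> carrier R" "Y \<in> carrier R"
    and "[n = n'] (mod int p)" "[i = i'] (mod int p)" "[j = j'] (mod int p)"
  shows "lin_comb X Y n i j = lin_comb X Y n' i' j'"
  using assms int_mult_cong[OF assms(1)] by (simp add: lin_comb_def)

end

lemma ring_hom_lin_comb:
  assumes "ring R" "ring S" "h \<in> ring_hom R S" "X \<in> carrier R" "Y \<in> carrier R"
  shows "h (ring.lin_comb R X Y n i j) = ring.lin_comb S (h X) (h Y) n i j"
proof -
  interpret R: ring R by fact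
  interpret S: ring S by fact
  show ?thesis
    using assms by (simp add: R.lin_comb_def S.lin_comb_def ring_hom_int_mult[OF assms(1-3)]
        ring_hom_add[OF assms(3)] ring_hom_one[OF assms(3)])
qed

text \<open>The functions \<open>n\<close>, \<open>i\<close>, \<open>j\<close> are representatives of the coordinates of a surjective homomorphism
  onto \<open>F\<^sub>p[x,y]/(x\<^sup>2, xy, y\<^sup>2)\<close> with respect to the basis \<open>1, x, y\<close>.\<close>

locale square_zero_coordinates = ring R for R (structure) +
  fixes p :: nat and n i j :: "'a \<Rightarrow> int" and a b :: 'a
  assumes prime: "Factorial_Ring.prime p"
    and add: "\<And>f x y. f \<in> {n, i, j} \<Longrightarrow> x \<in> carrier R \<Longrightarrow> y \<in> carrier R \<Longrightarrow>
      [f (x \<oplus> y) = f x + f y] (mod int p)"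
    and n_mult: "\<And>x y. x \<in> carrier R \<Longrightarrow> y \<in> carrier R \<Longrightarrow> [n (x \<otimes> y) = n x * n y] (mod int p)"
    and leibniz: "\<And>f x y. f \<in> {i, j} \<Longrightarrow> x \<in> carrier R \<Longrightarrow> y \<in> carrier R \<Longrightarrow>
      [f (x \<otimes> y) = n x * f y + f x * n y] (mod int p)"
    and one: "[n \<one> = 1] (mod int p)" "[i \<one> = 0] (mod int p)" "[j \<one> = 0] (mod int p)"
    and a: "a \<in> carrier R" "[n a = 0] (mod int p)" "[i a = 1] (mod int p)" "[j a = 0] (mod int p)"
    and b: "b \<in> carrier R" "[n b = 0] (mod int p)" "[i b = 0] (mod int p)" "[j b = 1] (mod int p)"

section \<open>Existence of coordinates on a noncommutative ring\<close>

context finite_local_prime_ring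
begin

text \<open>Write \<open>r = u + k\<close> with \<open>u \<in> J\<close> and \<open>k\<close> an
  integer. Multiplication by \<open>k\<close> preserves the additive group \<open>K\<close>, and
  multiplication by \<open>u\<close> sends \<open>K \<subseteq> J\<close> into
  \<open>J J \<subseteq> K\<close>.\<close>

lemma ideal_of_above_Phi:
  assumes K: "above_Phi K" "K \<subseteq> J"
  shows "ideal K R"
proof (rule idealI)
  note Ka = above_PhiD(1)[OF K(1)]
  show "ring R" by (rule ring_axioms)
  show "subgroup K (add_monoid R)" using Ka by (rule additive_subgroup.a_subgroup)
  fix x r assume x: "x \<in> K" and r: "r \<in> carrier R"
  obtain k :: int where k: "r \<ominus> [k] \<cdot> \<one> \<in> J" using decomposition r by blast
  define u where "u = r \<ominus> [k] \<cdot> \<one>"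
  have u: "u \<in> J" "r = u \<oplus> [k] \<cdot> \<one>"
    using k r by (simp_all add: u_def a_minus_def a_assoc l_neg)
  have c: "x \<in> carrier R" "x \<in> J" "u \<in> carrier R" using x K u J_carr by blast+
  have "r \<otimes> x = u \<otimes> x \<oplus> [k] \<cdot> x" "x \<otimes> r = x \<otimes> u \<oplus> [k] \<cdot> x"
    using c u by (simp_all add: l_distr r_distr int_mult_one_l int_mult_one_r)
  then show "r \<otimes> x \<in> K" "x \<otimes> r \<in> K"
    using above_PhiD(3)[OF K(1)] c u additive_subgroup.a_closed[OF Ka]
      additive_subgroup_int_mult_closed[OF Ka x] by auto
qed

text \<open>Every class in \<open>R/K\<close> has the form \<open>n + i a + j b\<close>, with
  coefficients unique modulo \<open>p\<close>. The axioms follow by comparing the chosen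
  coefficients of a sum or product with those computed from its operands.\<close>

lemma coordinates_exist:
  assumes nc: "\<not> cring R"
  shows "\<exists>n i j a b. square_zero_coordinates R p n i j a b"
proof -
  obtain K a b where K: "above_Phi K" "K \<subseteq> J" and ab: "a \<in> J" "b \<in> J"
    and ind: "independent K a b" and sp: "J \<subseteq> adjoin (adjoin K a) b"
    by (rule above_Phi_with_basis[OF nc])
  interpret K: ideal K R by (rule ideal_of_above_Phi[OF K])
  interpret Q: ring "R Quot K" by (rule K.quotient_is_ring)
  let ?h = "(+>) K"
  have h: "?h \<in> ring_hom R (R Quot K)" by (rule K.rcos_ring_hom)
  have abc: "a \<in> carrier R" "b \<in> carrier R" using ab J_carr by auto
  let ?X = "K +> a" and ?Y = "K +> b"
  have XY: "?X \<in> carrier (R Quot K)" "?Y \<in> carrier (R Quot K)"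
    using abc ring_hom_closed[OF h] by auto
  have h0: "?h x = \<zero>\<^bsub>R Quot K\<^esub>" if "x \<in> K" for x
    using a_rcos_zero[OF K.is_ideal that] by (simp add: FactRing_def)
  let ?D = "\<lambda>x n i j. K +> x = Q.lin_comb ?X ?Y n i j"
  have D_ex: "\<exists>n i j. ?D x n i j" if x: "x \<in> carrier R" for x
  proof -
    obtain n :: int where n: "x \<ominus> [n] \<cdot> \<one> \<in> J" using decomposition x by blast
    then obtain k and i j :: int where k: "k \<in> K" "x \<ominus> [n] \<cdot> \<one> = k \<oplus> [i] \<cdot> a \<oplus> [j] \<cdot> b"
      using sp unfolding adjoin_def by blast
    have "x = (x \<ominus> [n] \<cdot> \<one>) \<oplus> [n] \<cdot> \<one>" using x by (simp add: a_minus_def a_assoc l_neg)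
    also have "\<dots> = k \<oplus> lin_comb a b n i j"
      unfolding k(2) using abc k(1) by (simp add: lin_comb_def a_ac)
    finally have "?h x = ?h k \<oplus>\<^bsub>R Quot K\<^esub> ?h (lin_comb a b n i j)"
      using ring_hom_add[OF h] abc k(1) by simp
    then have "?D x n i j"
      using ring_hom_lin_comb[OF ring_axioms Q.ring_axioms h abc] h0[OF k(1)] XY by simp
    then show ?thesis by blast
  qed
  have D_uniq: "[n = n'] (mod int p) \<and> [i = i'] (mod int p) \<and> [j = j'] (mod int p)"
    if D: "?D x n i j" "?D x n' i' j'" for x n i j n' i' j'
  proof -
    have "?h (lin_comb a b n i j) = ?h (lin_comb a b n' i' j')"
      using D ring_hom_lin_comb[OF ring_axioms Q.ring_axioms h abc] by simp
    then have "lin_comb a b n i j \<ominus> lin_comb a b n' i' j' \<in> K"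
      using quotient_eq_iff_same_a_r_cos[OF K.is_ideal] abc by simp
    then have mem: "lin_comb a b (n - n') (i - i') (j - j') \<in> K"
      using abc by (simp add: lin_comb_diff)
    have abJ: "[(i - i')] \<cdot> a \<oplus> [(j - j')] \<cdot> b \<in> J"
      using additive_subgroup_int_mult_closed[OF J_add] ab additive_subgroup.a_closed[OF J_add] by blast
    have "[(n - n')] \<cdot> \<one> = lin_comb a b (n - n') (i - i') (j - j') \<ominus> ([(i - i')] \<cdot> a \<oplus> [(j - j')] \<cdot> b)"
      using abc by (simp add: lin_comb_def a_minus_def a_assoc r_neg)
    also have "\<dots> \<in> J"
      using mem K abJ by (intro additive_subgroup_minus_closed[OF J_add]) auto
    finally have nJ: "[(n - n')] \<cdot> \<one> \<in> J" .
    \<comment> \<open>Otherwise a Bezout combination of \<open>n - n'\<close> and \<open>p\<close>,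
      both of which lie in \<open>J\<close> as multiples of \<open>1\<close>, would put
      \<open>1\<close> into \<open>J\<close>.\<close>
    have nn: "int p dvd n - n'"
    proof (rule ccontr)
      assume "\<not> int p dvd n - n'"
      then have "coprime (int p) (n - n')" using prime by (intro prime_imp_coprime) auto
      then obtain u v where uv: "u * (n - n') + v * int p = 1"
        using bezout_int[of "n - n'" "int p"] by (metis coprime_iff_gcd_eq_1 gcd.commute)
      have "[u] \<cdot> ([(n - n')] \<cdot> \<one>) \<oplus> [v] \<cdot> ([int p] \<cdot> \<one>) \<in> J"
        using additive_subgroup_int_mult_closed[OF J_add] nJ p_in_J additive_subgroup.a_closed[OF J_add]
        by blast
      then have "[(u * (n - n') + v * int p)] \<cdot> \<one> \<in> J"
        by (simp only: int_mult_assoc int_mult_add one_closed)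
      then show False using uv one_notin_J by simp
    qed
    then obtain l where l: "n - n' = l * int p" by (metis dvd_def mult.commute)
    have "[(n - n')] \<cdot> \<one> \<in> K"
      using additive_subgroup_int_mult_closed[OF above_PhiD(1,2)[OF K(1)], of l]
      by (simp add: l int_mult_assoc)
    then have "lin_comb a b (n - n') (i - i') (j - j') \<ominus> [(n - n')] \<cdot> \<one> \<in> K"
      using mem by (intro additive_subgroup_minus_closed[OF above_PhiD(1)[OF K(1)]])
    moreover have "lin_comb a b (n - n') (i - i') (j - j') \<ominus> [(n - n')] \<cdot> \<one> =
        [(i - i')] \<cdot> a \<oplus> [(j - j')] \<cdot> b"
      using abc add_minus_cancel[of "[(n - n')] \<cdot> \<one>" "[(i - i')] \<cdot> a \<oplus> [(j - j')] \<cdot> b"]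
      by (simp add: lin_comb_def a_minus_def a_assoc)
    ultimately have "int p dvd i - i' \<and> int p dvd j - j'"
      using ind unfolding independent_def by metis
    with nn show ?thesis by (simp add: cong_iff_dvd_diff)
  qed
  obtain n i j where D: "\<And>x. x \<in> carrier R \<Longrightarrow> ?D x (n x) (i x) (j x)"
    using D_ex by metis
  have z: "?X \<otimes>\<^bsub>R Quot K\<^esub> ?X = \<zero>\<^bsub>R Quot K\<^esub>" "?X \<otimes>\<^bsub>R Quot K\<^esub> ?Y = \<zero>\<^bsub>R Quot K\<^esub>"
    "?Y \<otimes>\<^bsub>R Quot K\<^esub> ?X = \<zero>\<^bsub>R Quot K\<^esub>" "?Y \<otimes>\<^bsub>R Quot K\<^esub> ?Y = \<zero>\<^bsub>R Quot K\<^esub>"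
    using ring_hom_mult[OF h, symmetric] abc h0 above_PhiD(3)[OF K(1)] ab by simp_all
  have D_add: "?D (x \<oplus> y) (n x + n y) (i x + i y) (j x + j y)"
    if "x \<in> carrier R" "y \<in> carrier R" for x y
    using XY by (simp add: ring_hom_add[OF h that] D[OF that(1)] D[OF that(2)] Q.lin_comb_add)
  have D_mult: "?D (x \<otimes> y) (n x * n y) (n x * i y + i x * n y) (n x * j y + j x * n y)"
    if "x \<in> carrier R" "y \<in> carrier R" for x y
    using XY z by (simp add: ring_hom_mult[OF h that] D[OF that(1)] D[OF that(2)] Q.lin_comb_mult)
  have D_one: "?D \<one> 1 0 0" and D_a: "?D a 0 1 0" and D_b: "?D b 0 0 1"
    using XY ring_hom_one[OF h] by (simp_all add: Q.lin_comb_def)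
  have "square_zero_coordinates R p n i j a b"
    using D_uniq[OF D D_add] D_uniq[OF D D_mult] D_uniq[OF D D_one] D_uniq[OF D D_a]
      D_uniq[OF D D_b] abc prime by unfold_locales auto
  then show ?thesis by blast
qed

end

section \<open>Kernel, quotient, cover and surjection obtained from coordinates\<close>

context square_zero_coordinates
begin

lemma coord_zero: "f \<in> {n, i, j} \<Longrightarrow> [f \<zero> = 0] (mod int p)"
  using add[of f \<zero> \<zero>] by (simp add: cong_iff_dvd_diff)

lemma coord_uminus:
  assumes f: "f \<in> {n, i, j}" and x: "x \<in> carrier R"
  shows "[f (\<ominus> x) = - f x] (mod int p)"
proof -
  have "[f x + f (\<ominus> x) = 0] (mod int p)"
    using add[OF f x a_inv_closed[OF x]] coord_zero[OF f] x
    by (metis cong_trans cong_sym r_neg)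
  then show ?thesis by (simp add: cong_iff_dvd_diff add.commute)
qed

lemma coord_diff:
  assumes f: "f \<in> {n, i, j}" and x: "x \<in> carrier R" "y \<in> carrier R"
  shows "[f (x \<ominus> y) = f x - f y] (mod int p)"
  using cong_trans[OF add[OF f x(1) a_inv_closed[OF x(2)]]
      cong_add[OF cong_refl coord_uminus[OF f x(2)]]]
  by (simp add: a_minus_def)

definition ker :: "'a set"
  where "ker = {x \<in> carrier R. [n x = 0] (mod int p) \<and> [i x = 0] (mod int p) \<and> [j x = 0] (mod int p)}"

lemma ker_iff: "x \<in> ker \<longleftrightarrow> x \<in> carrier R \<and> (\<forall>f\<in>{n, i, j}. [f x = 0] (mod int p))"
  by (auto simp: ker_def)

lemma ideal_ker: "ideal ker R"
proof (rule idealI)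
  show "ring R" by (rule ring_axioms)
  have "additive_subgroup ker R"
  proof (rule additive_subgroup_of_closed)
    show "x \<oplus> y \<in> ker" if xy: "x \<in> ker" "y \<in> ker" for x y
    proof -
      have "[f (x \<oplus> y) = 0 + 0] (mod int p)" if "f \<in> {n, i, j}" for f
        using xy that unfolding ker_iff by (intro cong_trans[OF add cong_add]) blast+
      then show ?thesis using xy by (simp add: ker_iff)
    qed
    show "\<ominus> x \<in> ker" if x: "x \<in> ker" for x
    proof -
      have "[f (\<ominus> x) = - 0] (mod int p)" if f: "f \<in> {n, i, j}" for f
      proof (rule cong_trans[OF coord_uminus[OF f]])
        show "[- f x = - 0] (mod int p)"
          using x f unfolding ker_iff cong_minus_minus_iff by blast
      qed (use x in \<open>simp add: ker_iff\<close>)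
      then show ?thesis using x by (simp add: ker_iff)
    qed
    show "\<zero> \<in> ker" unfolding ker_iff using coord_zero by blast
  qed (auto simp: ker_def)
  then show "subgroup ker (add_monoid R)" by (rule additive_subgroup.a_subgroup)
  fix x r assume x: "x \<in> ker" and r: "r \<in> carrier R"
  have xc: "x \<in> carrier R" and x0: "[n x = 0] (mod int p)" "\<And>f. f \<in> {i, j} \<Longrightarrow> [f x = 0] (mod int p)"
    using x by (auto simp: ker_def)
  have "[n (r \<otimes> x) = n r * 0] (mod int p)"
    by (rule cong_trans[OF n_mult[OF r xc] cong_mult[OF cong_refl x0(1)]])
  moreover have "[f (r \<otimes> x) = n r * 0 + f r * 0] (mod int p)" if "f \<in> {i, j}" for f
    using that
    by (intro cong_trans[OF leibniz[OF that r xc] cong_add] cong_mult cong_refl x0)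
  ultimately show "r \<otimes> x \<in> ker" using r xc by (simp add: ker_def)
  have "[n (x \<otimes> r) = 0 * n r] (mod int p)"
    by (rule cong_trans[OF n_mult[OF xc r] cong_mult[OF x0(1) cong_refl]])
  moreover have "[f (x \<otimes> r) = 0 * f r + 0 * n r] (mod int p)" if "f \<in> {i, j}" for f
    using that
    by (intro cong_trans[OF leibniz[OF that xc r] cong_add] cong_mult cong_refl x0)
  ultimately show "x \<otimes> r \<in> ker" using r xc by (simp add: ker_def)
qed

text \<open>The coordinates of a product are symmetric in its factors modulo \<open>p\<close>, so
  every commutator \<open>x y - y x\<close> lies in \<open>ker\<close>.\<close>

lemma ker_neq_zero:
  assumes "\<not> cring R"
  shows "ker \<noteq> {\<zero>}"
proof
  assume k: "ker = {\<zero>}"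
  have "x \<otimes> y = y \<otimes> x" if xy: "x \<in> carrier R" "y \<in> carrier R" for x y
  proof -
    have "[f (x \<otimes> y) = f (y \<otimes> x)] (mod int p)" if f: "f \<in> {n, i, j}" for f
    proof -
      have "[f (x \<otimes> y) = f (y \<otimes> x)] (mod int p)" if "f = n"
        using n_mult[OF xy] n_mult[OF xy(2,1)] that
        by (metis cong_sym cong_trans mult.commute)
      moreover have "[f (x \<otimes> y) = f (y \<otimes> x)] (mod int p)" if "f \<in> {i, j}"
        using leibniz[OF that xy] leibniz[OF that xy(2,1)]
        by (metis cong_sym cong_trans mult.commute add.commute)
      ultimately show ?thesis using f by blast
    qed
    then have "x \<otimes> y \<ominus> y \<otimes> x \<in> ker"
      using coord_diff[of _ "x \<otimes> y" "y \<otimes> x"] xy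
      by (simp add: ker_iff cong_iff_dvd_diff) (metis dvd_diff_commute diff_add_cancel dvd_add)
    then show ?thesis using k xy by simp
  qed
  then have "cring R" by unfold_locales auto
  then show False using assms by contradiction
qed

text \<open>Modulo \<open>p\<close> the coordinates are constant on cosets of \<open>ker\<close>, so
  composing them with a choice \<open>s\<close> of representatives gives coordinates on the
  quotient. The upper bound on the covering number thereby applies to \<open>R/ker\<close>
  too.\<close>

lemma coordinates_quotient:
  "\<exists>n' i' j' a' b'. square_zero_coordinates (R Quot ker) p n' i' j' a' b'"
proof -
  interpret K: ideal ker R by (rule ideal_ker)
  interpret Q: ring "R Quot ker" by (rule K.quotient_is_ring)
  have h: "(+>) ker \<in> ring_hom R (R Quot ker)" by (rule K.rcos_ring_hom)
  have "\<exists>r. r \<in> carrier R \<and> A = ker +> r" if "A \<in> carrier (R Quot ker)" for A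
    using that by (auto simp: FactRing_simps)
  then obtain s where s: "\<And>A. A \<in> carrier (R Quot ker) \<Longrightarrow> s A \<in> carrier R \<and> A = ker +> s A"
    by metis
  have sf: "[f (s (ker +> x)) = f x] (mod int p)" if f: "f \<in> {n, i, j}" and x: "x \<in> carrier R" for f x
  proof -
    have sx: "s (ker +> x) \<in> carrier R" "ker +> x = ker +> s (ker +> x)"
      using s[OF ring_hom_closed[OF h x]] by auto
    then have "s (ker +> x) \<ominus> x \<in> ker"
      using quotient_eq_iff_same_a_r_cos[OF ideal_ker sx(1) x] by simp
    then have "[f (s (ker +> x) \<ominus> x) = 0] (mod int p)" using f by (auto simp: ker_iff)
    then have "[f (s (ker +> x)) - f x = 0] (mod int p)"
      using coord_diff[OF f sx(1) x] by (metis cong_sym cong_trans)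
    then show ?thesis by (simp add: cong_iff_dvd_diff)
  qed
  have sum: "s (A \<oplus>\<^bsub>R Quot ker\<^esub> B) = s (ker +> (s A \<oplus> s B))"
    and prod: "s (A \<otimes>\<^bsub>R Quot ker\<^esub> B) = s (ker +> (s A \<otimes> s B))"
    if "A \<in> carrier (R Quot ker)" "B \<in> carrier (R Quot ker)" for A B
    using s[OF that(1)] s[OF that(2)] ring_hom_add[OF h] ring_hom_mult[OF h] by metis+
  have one': "\<one>\<^bsub>R Quot ker\<^esub> = ker +> \<one>" using ring_hom_one[OF h] by simp
  have "square_zero_coordinates (R Quot ker) p (n \<circ> s) (i \<circ> s) (j \<circ> s) (ker +> a) (ker +> b)"
  proof unfold_locales
    fix f' A B assume f': "f' \<in> {n \<circ> s, i \<circ> s, j \<circ> s}"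
      and AB: "A \<in> carrier (R Quot ker)" "B \<in> carrier (R Quot ker)"
    then obtain f where f: "f \<in> {n, i, j}" "f' = f \<circ> s" by auto
    show "[f' (A \<oplus>\<^bsub>R Quot ker\<^esub> B) = f' A + f' B] (mod int p)"
      using cong_trans[OF sf[OF f(1)] add[OF f(1)]] s AB by (simp add: f(2) sum)
  next
    fix A B assume AB: "A \<in> carrier (R Quot ker)" "B \<in> carrier (R Quot ker)"
    show "[(n \<circ> s) (A \<otimes>\<^bsub>R Quot ker\<^esub> B) = (n \<circ> s) A * (n \<circ> s) B] (mod int p)"
      using cong_trans[OF sf[of n] n_mult] s AB by (simp add: prod)
  next
    fix f' A B assume f': "f' \<in> {i \<circ> s, j \<circ> s}"
      and AB: "A \<in> carrier (R Quot ker)" "B \<in> carrier (R Quot ker)"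
    then obtain f where f: "f \<in> {i, j}" "f' = f \<circ> s" by auto
    show "[f' (A \<otimes>\<^bsub>R Quot ker\<^esub> B) = (n \<circ> s) A * f' B + f' A * (n \<circ> s) B] (mod int p)"
      using cong_trans[OF sf[of f] leibniz[OF f(1)]] f s AB by (auto simp: f(2) prod)
  qed (use prime ring_hom_closed[OF h] a b one cong_trans[OF sf[OF _ a(1)]] cong_trans[OF sf[OF _ b(1)]]
      cong_trans[OF sf[OF _ one_closed]] in \<open>auto simp: one'\<close>)
  then show ?thesis by blast
qed

text \<open>By the Leibniz rule the pair \<open>(i, j)\<close> of \<open>x y\<close> is
  \<open>n x\<close> times the pair of \<open>y\<close> plus \<open>n y\<close> times the pair of
  \<open>x\<close>, so any linear condition on the pair survives products.\<close>

lemma subrng_of_linear_condition: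
  assumes S: "S = {x \<in> carrier R. [c * i x = d * j x] (mod int p)}"
  shows "subrng S R"
proof -
  have "additive_subgroup S R"
  proof (rule additive_subgroup_of_closed)
    show "S \<subseteq> carrier R" by (auto simp: S)
    show "\<zero> \<in> S" using coord_zero[of i] coord_zero[of j]
      by (auto simp: S cong_0_iff cong_iff_dvd_diff)
    show "x \<oplus> y \<in> S" if "x \<in> S" "y \<in> S" for x y
    proof -
      have xy: "x \<in> carrier R" "y \<in> carrier R"
        and e: "[c * i x = d * j x] (mod int p)" "[c * i y = d * j y] (mod int p)"
        using that by (auto simp: S)
      have "[c * i (x \<oplus> y) = c * (i x + i y)] (mod int p)"
        by (intro cong_mult cong_refl add xy) auto
      also have "[c * (i x + i y) = d * (j x + j y)] (mod int p)"
        using cong_add[OF e] by (simp add: distrib_left)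
      also have "[d * (j x + j y) = d * j (x \<oplus> y)] (mod int p)"
        by (intro cong_mult cong_refl cong_sym[OF add] xy) auto
      finally show ?thesis using xy by (simp add: S)
    qed
    show "\<ominus> x \<in> S" if "x \<in> S" for x
    proof -
      have x: "x \<in> carrier R" and e: "[c * i x = d * j x] (mod int p)"
        using that by (auto simp: S)
      have "[c * i (\<ominus> x) = c * (- i x)] (mod int p)"
        by (intro cong_mult cong_refl coord_uminus x) auto
      also have "[c * (- i x) = d * (- j x)] (mod int p)"
        using e by (simp add: cong_minus_minus_iff)
      also have "[d * (- j x) = d * j (\<ominus> x)] (mod int p)"
        by (intro cong_mult cong_refl cong_sym[OF coord_uminus] x) auto
      finally show ?thesis using x by (simp add: S)
    qed
  qed
  moreover have "x \<otimes> y \<in> S" if "x \<in> S" "y \<in> S" for x y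
  proof -
    have xy: "x \<in> carrier R" "y \<in> carrier R"
      and e: "[c * i x = d * j x] (mod int p)" "[c * i y = d * j y] (mod int p)"
      using that by (auto simp: S)
    have "[c * i (x \<otimes> y) = c * (n x * i y + i x * n y)] (mod int p)"
      by (intro cong_mult cong_refl leibniz xy) auto
    also have "c * (n x * i y + i x * n y) = n x * (c * i y) + (c * i x) * n y"
      by (simp add: algebra_simps)
    also have "[n x * (c * i y) + (c * i x) * n y = n x * (d * j y) + (d * j x) * n y] (mod int p)"
      by (intro cong_add cong_mult cong_refl e)
    also have "n x * (d * j y) + (d * j x) * n y = d * (n x * j y + j x * n y)"
      by (simp add: algebra_simps)
    also have "[d * (n x * j y + j x * n y) = d * j (x \<otimes> y)] (mod int p)"
      by (intro cong_mult cong_refl cong_sym[OF leibniz] xy) auto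
    finally show ?thesis using xy by (simp add: S)
  qed
  ultimately show ?thesis by (simp add: subrng_def)
qed

text \<open>The preimages of the \<open>p + 1\<close> lines of the plane spanned by \<open>x\<close> and \<open>y\<close>.\<close>

lemma covering_number_le: "covering_number R \<le> enat (p + 1)"
proof -
  \<comment> \<open>\<open>?H c\<close> belongs to the line of slope \<open>c\<close>, and
    \<open>?V\<close> to the vertical line. The element \<open>b\<close> lies on no line of finite
    slope and \<open>a\<close> is not on the vertical one, which makes all of them proper.\<close>
  let ?H = "\<lambda>c. {x \<in> carrier R. [c * i x = 1 * j x] (mod int p)}"
  let ?V = "{x \<in> carrier R. [1 * i x = 0 * j x] (mod int p)}"
  let ?C = "insert ?V (?H ` {0..<int p})"
  have p1: "1 < int p" using prime prime_gt_1_nat by auto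
  have "card (?H ` {0..<int p}) \<le> p" using card_image_le[of "{0..<int p}" ?H] by simp
  then have card: "card ?C \<le> p + 1"
    using card_insert_if[of "?H ` {0..<int p}" ?V] by (simp split: if_splits)
  have not01: "\<not> [0 = 1] (mod int p)" "\<not> [1 = 0] (mod int p)"
    using p1 by (auto simp: cong_def)
  have "b \<notin> ?H c" for c
  proof
    assume "b \<in> ?H c"
    then have "[c * i b = j b] (mod int p)" by simp
    moreover have "[c * i b = c * 0] (mod int p)" by (intro cong_mult cong_refl b)
    ultimately show False using b(4) not01 by (metis cong_sym cong_trans mult_zero_right)
  qed
  then have proper1: "?H c \<noteq> carrier R" for c using b(1) by blast
  have "a \<notin> ?V" using a(3) not01 by (auto dest: cong_sym cong_trans)
  then have proper2: "?V \<noteq> carrier R" using a(1) by blast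
  have "x \<in> \<Union>?C" if x: "x \<in> carrier R" for x
  proof (cases "int p dvd i x")
    case True
    then show ?thesis using x by (simp add: cong_0_iff)
  next
    case False
    then have "coprime (i x) (int p)"
      using prime prime_imp_coprime[of "int p" "i x"] by (simp add: coprime_commute)
    \<comment> \<open>\<open>u\<close> inverts \<open>i x\<close> modulo \<open>p\<close>, so
      \<open>?c\<close> is the slope \<open>j x / i x\<close>.\<close>
    then obtain u where u: "[i x * u = 1] (mod int p)" using cong_solve_coprime_int by blast
    let ?c = "(j x * u) mod int p"
    have "[?c * i x = (j x * u) * i x] (mod int p)"
      by (intro cong_mult cong_refl) (simp add: cong_def)
    also have "(j x * u) * i x = j x * (i x * u)" by simp
    also have "[j x * (i x * u) = j x * 1] (mod int p)" by (intro cong_mult cong_refl u)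
    finally have "x \<in> ?H ?c" using x by simp
    moreover have "?c \<in> {0..<int p}" using p1 by simp
    ultimately show ?thesis by blast
  qed
  then have "\<Union>?C = carrier R" by blast
  moreover have "subrng S R \<and> S \<noteq> carrier R" if "S \<in> ?C" for S
    using that
  proof (elim insertE imageE)
    assume "S = ?V"
    then show ?thesis using subrng_of_linear_condition[of ?V 1 0] proper2 by simp
  next
    fix c assume "S = ?H c"
    then show ?thesis using subrng_of_linear_condition[of S c 1] proper1[of c] by simp
  qed
  ultimately have "subrng_cover ?C R"
    unfolding subrng_cover_def by (intro conjI ballI) simp_all
  then have "covering_number R \<le> enat (card ?C)"
    unfolding covering_number_def by (intro Inf_lower) auto
  also have "\<dots> \<le> enat (p + 1)" using card by simp
  finally show ?thesis .
qed

text \<open>As \<open>p\<close> kills \<open>Q\<close>, coordinates known only modulo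
  \<open>p\<close> give a well-behaved map sending \<open>x\<close> to
  \<open>n x + (i x) X + (j x) Y\<close>; it maps \<open>a\<close> to \<open>X\<close> and
  \<open>b\<close> to \<open>Y\<close>, so its image contains the span of
  \<open>1, X, Y\<close>.\<close>

lemma hom_onto_lin_combs:
  assumes Q: "ring Q" and X: "X \<in> carrier Q" and Y: "Y \<in> carrier Q"
    and z: "X \<otimes>\<^bsub>Q\<^esub> X = \<zero>\<^bsub>Q\<^esub>" "X \<otimes>\<^bsub>Q\<^esub> Y = \<zero>\<^bsub>Q\<^esub>" "Y \<otimes>\<^bsub>Q\<^esub> X = \<zero>\<^bsub>Q\<^esub>" "Y \<otimes>\<^bsub>Q\<^esub> Y = \<zero>\<^bsub>Q\<^esub>"
    and p: "[int p] \<cdot>\<^bsub>Q\<^esub> \<one>\<^bsub>Q\<^esub> = \<zero>\<^bsub>Q\<^esub>"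
    and span: "\<And>q. q \<in> carrier Q \<Longrightarrow> \<exists>n i j. q = ring.lin_comb Q X Y n i j"
  shows "\<exists>h\<in>ring_hom R Q. h ` carrier R = carrier Q"
proof -
  interpret Q: ring Q by (rule Q)
  let ?h = "\<lambda>x. Q.lin_comb X Y (n x) (i x) (j x)"
  have h: "?h \<in> ring_hom R Q"
  proof (rule ring_hom_memI)
    fix x y assume xy: "x \<in> carrier R" "y \<in> carrier R"
    show "?h (x \<otimes> y) = ?h x \<otimes>\<^bsub>Q\<^esub> ?h y"
      unfolding Q.lin_comb_mult[OF X Y z]
      by (intro Q.lin_comb_cong[OF p X Y] n_mult leibniz xy) auto
    show "?h (x \<oplus> y) = ?h x \<oplus>\<^bsub>Q\<^esub> ?h y"
      unfolding Q.lin_comb_add[OF X Y]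
      by (intro Q.lin_comb_cong[OF p X Y] add xy) auto
  next
    have "?h \<one> = Q.lin_comb X Y 1 0 0" by (intro Q.lin_comb_cong[OF p X Y] one)
    then show "?h \<one> = \<one>\<^bsub>Q\<^esub>" using X Y by (simp add: Q.lin_comb_def)
  qed (use X Y in auto)
  have "?h a = Q.lin_comb X Y 0 1 0" by (intro Q.lin_comb_cong[OF p X Y] a)
  then have ha: "?h a = X" using X Y by (simp add: Q.lin_comb_def)
  have "?h b = Q.lin_comb X Y 0 0 1" by (intro Q.lin_comb_cong[OF p X Y] b)
  then have hb: "?h b = Y" using X Y by (simp add: Q.lin_comb_def)
  have "q \<in> ?h ` carrier R" if q: "q \<in> carrier Q" for q
  proof -
    obtain k l m where "q = Q.lin_comb X Y k l m" using span[OF q] by blast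
    then have "q = ?h (lin_comb a b k l m)"
      using ring_hom_lin_comb[OF ring_axioms Q h a(1) b(1)] ha hb by simp
    then show ?thesis by (rule image_eqI) (rule lin_comb_closed[OF a(1) b(1)])
  qed
  then have "?h ` carrier R = carrier Q" using ring_hom_closed[OF h] by blast
  then show ?thesis using h by blast
qed

end

section \<open>Lower bound for the covering number\<close>

context finite_local_prime_ring
begin

text \<open>From \<open>p 1 \<in> J\<close> it follows that \<open>p^(m+1) 1 \<in> J^(m+1)\<close>,
  which is zero for a suitable \<open>m\<close>.\<close>

lemma p_power_torsion: "\<exists>m. \<forall>x\<in>carrier R. [(int p ^ m)] \<cdot> x = \<zero>"
proof -
  have "[(int p ^ Suc m)] \<cdot> \<one> \<in> J_power m" for m
  proof (induct m)
    case 0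
    then show ?case using p_in_J by simp
  next
    case (Suc m)
    have "[(int p ^ Suc (Suc m))] \<cdot> \<one> = [int p] \<cdot> \<one> \<otimes> [(int p ^ Suc m)] \<cdot> \<one>"
      by (simp only: int_mult_one_l int_mult_assoc add.int_pow_closed one_closed power_Suc)
    then show ?case using ideal_prod.prod[OF p_in_J Suc, of R] by simp
  qed
  moreover obtain m where "J_power m = {\<zero>}" using J_power_eq_zero by blast
  ultimately have "[(int p ^ Suc m)] \<cdot> \<one> = \<zero>" by blast
  then have "[(int p ^ Suc m)] \<cdot> x = \<zero>" if "x \<in> carrier R" for x
    using int_mult_one_l[OF that, of "int p ^ Suc m"] that by simp
  then show ?thesis by blast
qed

text \<open>For \<open>a \<notin> H\<close> the cosets \<open>H + k a\<close> with
  \<open>0 \<le> k < p\<close> are distinct: if \<open>k a \<in> H\<close> with \<open>k\<close>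
  prime to \<open>p\<close>, then a Bezout identity for \<open>k\<close> and \<open>p^m\<close>,
  where \<open>p^m\<close> kills \<open>a\<close>, gives \<open>a \<in> H\<close>.\<close>

lemma card_proper_additive_subgroup:
  assumes H: "additive_subgroup H R" "H \<noteq> carrier R"
  shows "p * card H \<le> card (carrier R)"
proof -
  note Hc = additive_subgroup.a_Hcarr[OF H(1)]
  obtain a where a: "a \<in> carrier R" "a \<notin> H" using H Hc by blast
  obtain m where m: "\<And>x. x \<in> carrier R \<Longrightarrow> [(int p ^ m)] \<cdot> x = \<zero>" using p_power_torsion by blast
  have dvd: "int p dvd k" if k: "[k] \<cdot> a \<in> H" for k :: int
  proof (rule ccontr)
    assume "\<not> int p dvd k"
    then have "coprime (int p) k" using prime by (intro prime_imp_coprime) auto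
    then have "coprime (int p ^ m) k" by simp
    then obtain u v where uv: "u * k + v * int p ^ m = 1"
      using bezout_int[of k "int p ^ m"] by (metis coprime_iff_gcd_eq_1 gcd.commute)
    have "a = [(u * k + v * int p ^ m)] \<cdot> a" using uv a by simp
    also have "\<dots> = [u] \<cdot> ([k] \<cdot> a) \<oplus> [v] \<cdot> ([(int p ^ m)] \<cdot> a)"
      using a(1) by (simp only: int_mult_add int_mult_assoc)
    also have "\<dots> = [u] \<cdot> ([k] \<cdot> a)" using a(1) m by (simp add: add.int_pow_one)
    also have "\<dots> \<in> H" by (rule additive_subgroup_int_mult_closed[OF H(1) k])
    finally show False using a by blast
  qed
  let ?f = "\<lambda>(h, k). h \<oplus> [int k] \<cdot> a"
  have "inj_on ?f (H \<times> {..<p})"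
  proof (rule inj_onI, clarify)
    fix h k h' k' assume h: "h \<in> H" "h' \<in> H" and k: "k < p" "k' < p"
      and e: "h \<oplus> [int k] \<cdot> a = h' \<oplus> [int k'] \<cdot> a"
    have "[(int k - int k')] \<cdot> a = [int k] \<cdot> a \<ominus> [int k'] \<cdot> a"
      using a int_mult_add[of a "int k" "- int k'"] by (simp add: int_mult_uminus a_minus_def)
    also have "\<dots> = (h \<oplus> [int k] \<cdot> a) \<oplus> \<ominus> h \<oplus> \<ominus> ([int k'] \<cdot> a)"
      using a h Hc by (simp add: add_minus_cancel a_minus_def)
    also have "\<dots> = h' \<ominus> h"
      unfolding e using a h Hc by (simp add: a_minus_def a_ac r_neg1 r_neg2 r_neg)
    also have "\<dots> \<in> H" using additive_subgroup_minus_closed[OF H(1)] h by blast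
    finally have "int p dvd int k - int k'" by (rule dvd)
    then have "k = k'" using k by (metis mod_eq_dvd_iff zmod_int mod_less of_nat_eq_iff)
    then show "h = h' \<and> k = k'" using e a h Hc by simp
  qed
  moreover have "?f ` (H \<times> {..<p}) \<subseteq> carrier R" using a Hc by auto
  ultimately have "card (H \<times> {..<p}) \<le> card (carrier R)"
    using finite_carrier by (rule card_inj_on_le)
  then show ?thesis by (simp add: card_cartesian_product mult.commute)
qed

text \<open>\<open>0\<close> lies in all members of the cover, so \<open>p\<close> subgroups of index at least \<open>p\<close> are too few.\<close>

lemma covering_number_ge: "enat (p + 1) \<le> covering_number R"
  unfolding covering_number_def
proof (rule Inf_greatest, clarify)
  fix C assume C: "finite C" "subrng_cover C R"
  have Ha: "additive_subgroup H R" "H \<noteq> carrier R" if "H \<in> C" for H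
    using that C by (auto simp: subrng_cover_def subrng_def)
  have p2: "2 \<le> p" using prime prime_ge_2_nat by auto
  let ?N = "card (carrier R)"
  have "\<not> card C \<le> p"
  proof
    assume Cp: "card C \<le> p"
    have fin: "finite H" and H0: "\<zero> \<in> H" if "H \<in> C" for H
      using additive_subgroup.a_subset[OF Ha(1)[OF that]] finite_carrier finite_subset
        additive_subgroup.zero_closed[OF Ha(1)[OF that]] by auto
    have "carrier R - {\<zero>} \<subseteq> (\<Union>H\<in>C. H - {\<zero>})"
      using C by (auto simp: subrng_cover_def)
    moreover have "finite (\<Union>H\<in>C. H - {\<zero>})" using C fin by auto
    ultimately have "card (carrier R - {\<zero>}) \<le> card (\<Union>H\<in>C. H - {\<zero>})" by (rule card_mono[rotated])
    also have "\<dots> \<le> (\<Sum>H\<in>C. card (H - {\<zero>}))" by (rule card_UN_le[OF C(1)])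
    \<comment> \<open>The count of nonzero elements is multiplied by \<open>p\<close>, so that the
      bound \<open>N/p - 1\<close> for each member is used as \<open>N - p\<close>, without
      division.\<close>
    finally have "p * (?N - 1) \<le> (\<Sum>H\<in>C. p * card (H - {\<zero>}))"
      using finite_carrier by (simp add: card_Diff_singleton sum_distrib_left[symmetric])
    also have "\<dots> \<le> (\<Sum>H\<in>C. ?N - p)"
    proof (rule sum_mono)
      fix H assume "H \<in> C"
      then show "p * card (H - {\<zero>}) \<le> ?N - p"
        using card_proper_additive_subgroup[OF Ha] H0 fin
        by (simp add: card_Diff_singleton diff_mult_distrib2 diff_le_mono)
    qed
    also have "\<dots> = card C * (?N - p)" by simp
    also have "\<dots> \<le> p * (?N - p)" using Cp by (rule mult_le_mono1)
    finally have "?N - 1 \<le> ?N - p" using p2 by simp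
    moreover have "0 < ?N" using finite_carrier zero_closed card_gt_0_iff by blast
    \<comment> \<open>This gives \<open>p \<le> N\<close>, so the natural-number subtraction
      \<open>N - p\<close> is not truncated and \<open>N - 1 \<le> N - p\<close> is absurd.\<close>
    moreover have "p * card {\<zero>} \<le> ?N"
    proof (rule card_proper_additive_subgroup)
      show "additive_subgroup {\<zero>} R" by (rule additive_subgroup_of_closed) auto
      show "{\<zero>} \<noteq> carrier R" 
        using one_notin_J additive_subgroup.zero_closed[OF J_add] one_closed by (metis singletonD)
    qed
    ultimately show False using p2 by simp
  qed
  then show "enat (p + 1) \<le> enat (card C)" by simp
qed

end

section \<open>The ring \<open>F\<^sub>p[x,y]/(x\<^sup>2, xy, y\<^sup>2)\<close>\<close>

text \<open>An induction principle for polynomials: monomials arise from constants by repeated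
  multiplication by the variable, and every polynomial is a finite sum of monomials.\<close>

lemma (in UP_ring) carrier_subset_of_closed:
  assumes const: "\<And>c. c \<in> carrier R \<Longrightarrow> monom P c 0 \<in> S"
    and add: "\<And>f g. f \<in> S \<Longrightarrow> g \<in> S \<Longrightarrow> f \<oplus>\<^bsub>P\<^esub> g \<in> S"
    and mult: "\<And>f. f \<in> S \<Longrightarrow> f \<otimes>\<^bsub>P\<^esub> monom P \<one> 1 \<in> S"
  shows "carrier P \<subseteq> S"
proof
  fix f assume f: "f \<in> carrier P"
  have monom: "monom P c k \<in> S" if "c \<in> carrier R" for c k
  proof (induct k)
    case (Suc k)
    have "monom P c (Suc k) = monom P c k \<otimes>\<^bsub>P\<^esub> monom P \<one> 1"
      using monom_mult[OF that R.one_closed, of k 1] that by simp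
    then show ?case using mult[OF Suc] by simp
  qed (rule const[OF that])
  have "(\<Oplus>\<^bsub>P\<^esub>i\<in>A. monom P (coeff P f i) i) \<in> S" if "finite A" for A
    using that
  proof induct
    case empty
    show ?case using const[OF R.zero_closed] by simp
  next
    case (insert x A)
    then show ?case using f monom add by (subst P.finsum_insert) auto
  qed
  then show "f \<in> S" using up_repr[OF f] by (metis finite_atMost)
qed

text \<open>This supplies the assumptions of \<open>hom_onto_lin_combs\<close>, with
  \<open>X\<close>, \<open>Y\<close> the classes of the variables. For spanning, the polynomials
  whose class is a combination of \<open>1, X, Y\<close> are closed under sums and products and
  contain constants and both variables.\<close>

lemma square_zero_quot_structure:
  fixes p :: nat
  assumes p: "Factorial_Ring.prime p"
  defines "Q \<equiv> square_zero_quot (residue_ring (int p))"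
  shows "\<exists>X\<in>carrier Q. \<exists>Y\<in>carrier Q. ring Q
    \<and> X \<otimes>\<^bsub>Q\<^esub> X = \<zero>\<^bsub>Q\<^esub> \<and> X \<otimes>\<^bsub>Q\<^esub> Y = \<zero>\<^bsub>Q\<^esub> \<and> Y \<otimes>\<^bsub>Q\<^esub> X = \<zero>\<^bsub>Q\<^esub> \<and> Y \<otimes>\<^bsub>Q\<^esub> Y = \<zero>\<^bsub>Q\<^esub>
    \<and> [int p] \<cdot>\<^bsub>Q\<^esub> \<one>\<^bsub>Q\<^esub> = \<zero>\<^bsub>Q\<^esub>
    \<and> (\<forall>q\<in>carrier Q. \<exists>n i j. q = ring.lin_comb Q X Y n i j)"
proof -
  have p1: "1 < int p" using p prime_gt_1_nat by auto
  define K where "K = residue_ring (int p)"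
  interpret K: residues "int p" K by unfold_locales (use p1 in \<open>auto simp: K_def\<close>)
  interpret U: UP_cring K "UP K" by unfold_locales
  interpret V: UP_cring "UP K" "UP2 K" by unfold_locales
  define x y where "x = UP2_x K" and "y = UP2_y K"
  define I where "I = Idl\<^bsub>UP2 K\<^esub> {x \<otimes>\<^bsub>UP2 K\<^esub> x, x \<otimes>\<^bsub>UP2 K\<^esub> y, y \<otimes>\<^bsub>UP2 K\<^esub> y}"
  have Q: "Q = UP2 K Quot I"
    by (simp add: Q_def square_zero_quot_def K_def I_def x_def y_def)
  have xy: "x \<in> carrier (UP2 K)" "y \<in> carrier (UP2 K)" by (simp_all add: x_def y_def UP2_x_def UP2_y_def)
  have I: "ideal I (UP2 K)" unfolding I_def using xy by (intro V.P.genideal_ideal) auto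
  interpret I: ideal I "UP2 K" by (rule I)
  interpret Q: ring Q unfolding Q by (rule I.quotient_is_ring)
  define h where "h = (+>\<^bsub>UP2 K\<^esub>) I"
  have h: "h \<in> ring_hom (UP2 K) Q" unfolding h_def Q by (rule I.rcos_ring_hom)
  \<comment> \<open>The embedding of \<open>F_p\<close> as doubly constant polynomials, followed by
    the quotient map, identifies classes of constants with integer multiples of \<open>1\<close> and
    yields \<open>p 1 = 0\<close>.\<close>
  have c: "h \<circ> (\<lambda>k. monom (UP2 K) (monom (UP K) k 0) 0) \<in> ring_hom K Q"
    using ring_hom_trans[OF U.const_ring_hom V.const_ring_hom] h
    by (intro ring_hom_trans[OF _ h]) (simp add: comp_def)
  let ?X = "h x" and ?Y = "h y"
  have XY: "?X \<in> carrier Q" "?Y \<in> carrier Q" using ring_hom_closed[OF h] xy by auto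
  have h0: "h f = \<zero>\<^bsub>Q\<^esub>" if "f \<in> I" for f
    using V.P.a_rcos_zero[OF I that] by (simp add: h_def Q FactRing_def)
  have mem: "x \<otimes>\<^bsub>UP2 K\<^esub> x \<in> I" "x \<otimes>\<^bsub>UP2 K\<^esub> y \<in> I" "y \<otimes>\<^bsub>UP2 K\<^esub> y \<in> I"
    unfolding I_def using xy V.P.genideal_self[of "{x \<otimes>\<^bsub>UP2 K\<^esub> x, x \<otimes>\<^bsub>UP2 K\<^esub> y, y \<otimes>\<^bsub>UP2 K\<^esub> y}"] by auto
  have z: "?X \<otimes>\<^bsub>Q\<^esub> ?X = \<zero>\<^bsub>Q\<^esub>" "?X \<otimes>\<^bsub>Q\<^esub> ?Y = \<zero>\<^bsub>Q\<^esub>" "?Y \<otimes>\<^bsub>Q\<^esub> ?X = \<zero>\<^bsub>Q\<^esub>" "?Y \<otimes>\<^bsub>Q\<^esub> ?Y = \<zero>\<^bsub>Q\<^esub>"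
    using ring_hom_mult[OF h, symmetric] xy h0 mem V.P.m_comm[OF xy(2) xy(1)] by auto
  have ck: "h (monom (UP2 K) (monom (UP K) (k mod int p) 0) 0) = [k] \<cdot>\<^bsub>Q\<^esub> \<one>\<^bsub>Q\<^esub>" for k :: int
    using ring_hom_int_mult[OF K.ring_axioms Q.ring_axioms c K.one_closed, of k]
      residue_ring_int_mult_one[OF p1, of k] ring_hom_one[OF c]
    by (simp add: K_def)
  have "[int p] \<cdot>\<^bsub>Q\<^esub> \<one>\<^bsub>Q\<^esub> = [(0 :: int)] \<cdot>\<^bsub>Q\<^esub> \<one>\<^bsub>Q\<^esub>"
    using ck[of "int p"] ck[of 0] by simp
  then have pQ: "[int p] \<cdot>\<^bsub>Q\<^esub> \<one>\<^bsub>Q\<^esub> = \<zero>\<^bsub>Q\<^esub>" by simp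
  let ?S = "{f \<in> carrier (UP2 K). \<exists>n i j. h f = Q.lin_comb ?X ?Y n i j}"
  have S_add: "f \<oplus>\<^bsub>UP2 K\<^esub> g \<in> ?S" if S: "f \<in> ?S" "g \<in> ?S" for f g
  proof -
    have fg: "f \<in> carrier (UP2 K)" "g \<in> carrier (UP2 K)" using S by auto
    obtain n i j n' i' j' where "h f = Q.lin_comb ?X ?Y n i j" "h g = Q.lin_comb ?X ?Y n' i' j'"
      using S by blast
    then have "h (f \<oplus>\<^bsub>UP2 K\<^esub> g) = Q.lin_comb ?X ?Y n i j \<oplus>\<^bsub>Q\<^esub> Q.lin_comb ?X ?Y n' i' j'"
      by (simp only: ring_hom_add[OF h fg])
    then have "\<exists>n i j. h (f \<oplus>\<^bsub>UP2 K\<^esub> g) = Q.lin_comb ?X ?Y n i j"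
      unfolding Q.lin_comb_add[OF XY] by blast
    then show ?thesis using fg by simp
  qed
  have S_mult: "f \<otimes>\<^bsub>UP2 K\<^esub> g \<in> ?S" if S: "f \<in> ?S" "g \<in> ?S" for f g
  proof -
    have fg: "f \<in> carrier (UP2 K)" "g \<in> carrier (UP2 K)" using S by auto
    obtain n i j n' i' j' where "h f = Q.lin_comb ?X ?Y n i j" "h g = Q.lin_comb ?X ?Y n' i' j'"
      using S by blast
    then have "h (f \<otimes>\<^bsub>UP2 K\<^esub> g) = Q.lin_comb ?X ?Y n i j \<otimes>\<^bsub>Q\<^esub> Q.lin_comb ?X ?Y n' i' j'"
      by (simp only: ring_hom_mult[OF h fg])
    then have "\<exists>n i j. h (f \<otimes>\<^bsub>UP2 K\<^esub> g) = Q.lin_comb ?X ?Y n i j"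
      unfolding Q.lin_comb_mult[OF XY z] by blast
    then show ?thesis using fg by simp
  qed
  have "?X = Q.lin_comb ?X ?Y 0 1 0" "?Y = Q.lin_comb ?X ?Y 0 0 1"
    using XY by (simp_all add: Q.lin_comb_def)
  then have xyS: "x \<in> ?S" "y \<in> ?S" using xy by blast+
  \<comment> \<open>Polynomial induction is used once per layer: here for polynomials in
    \<open>x\<close>, seen as constants in \<open>y\<close>, and afterwards for polynomials in
    \<open>y\<close> over them.\<close>
  have const: "monom (UP2 K) f 0 \<in> ?S" if "f \<in> carrier (UP K)" for f
  proof -
    have "carrier (UP K) \<subseteq> {f \<in> carrier (UP K). monom (UP2 K) f 0 \<in> ?S}"
    proof (rule U.carrier_subset_of_closed)
      fix k assume k: "k \<in> carrier K"
      then have "k mod int p = k" by (simp add: K.res_carrier_eq)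
      then have "h (monom (UP2 K) (monom (UP K) k 0) 0) = [k] \<cdot>\<^bsub>Q\<^esub> \<one>\<^bsub>Q\<^esub>" using ck[of k] by simp
      also have "\<dots> = Q.lin_comb ?X ?Y k 0 0" using XY by (simp add: Q.lin_comb_def)
      finally show "monom (UP K) k 0 \<in> {f \<in> carrier (UP K). monom (UP2 K) f 0 \<in> ?S}"
        using k by auto
    next
      fix f g assume fg: "f \<in> {f \<in> carrier (UP K). monom (UP2 K) f 0 \<in> ?S}"
        "g \<in> {f \<in> carrier (UP K). monom (UP2 K) f 0 \<in> ?S}"
      then have "monom (UP2 K) (f \<oplus>\<^bsub>UP K\<^esub> g) 0 = monom (UP2 K) f 0 \<oplus>\<^bsub>UP2 K\<^esub> monom (UP2 K) g 0"
        by simp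
      moreover have "\<dots> \<in> ?S" by (rule S_add) (use fg in blast)+
      ultimately show "f \<oplus>\<^bsub>UP K\<^esub> g \<in> {f \<in> carrier (UP K). monom (UP2 K) f 0 \<in> ?S}"
        using fg by simp
    next
      fix f assume f: "f \<in> {f \<in> carrier (UP K). monom (UP2 K) f 0 \<in> ?S}"
      then have "monom (UP2 K) (f \<otimes>\<^bsub>UP K\<^esub> monom (UP K) \<one>\<^bsub>K\<^esub> 1) 0 = monom (UP2 K) f 0 \<otimes>\<^bsub>UP2 K\<^esub> x"
        using V.monom_mult[of f "monom (UP K) \<one>\<^bsub>K\<^esub> 1" 0 0] by (simp add: x_def UP2_x_def)
      moreover have "\<dots> \<in> ?S" by (rule S_mult) (use f xyS in blast)+
      ultimately show "f \<otimes>\<^bsub>UP K\<^esub> monom (UP K) \<one>\<^bsub>K\<^esub> 1 \<in> {f \<in> carrier (UP K). monom (UP2 K) f 0 \<in> ?S}"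
        using f by simp
    qed
    then show ?thesis using that by blast
  qed
  have "carrier (UP2 K) \<subseteq> ?S"
    by (rule V.carrier_subset_of_closed[OF const S_add])
      (use S_mult[OF _ xyS(2)] in \<open>auto simp: y_def UP2_y_def\<close>)
  moreover have "\<exists>f\<in>carrier (UP2 K). q = h f" if "q \<in> carrier Q" for q
    using that by (auto simp: Q h_def FactRing_simps)
  ultimately have span: "\<forall>q\<in>carrier Q. \<exists>n i j. q = Q.lin_comb ?X ?Y n i j" by blast
  show ?thesis by (intro bexI[OF _ XY(1)] bexI[OF _ XY(2)] conjI z pQ span Q.ring_axioms)
qed

theorem proposition5p3:
  fixes p :: nat and R :: "('a, 'b) ring_scheme"
  assumes "Factorial_Ring.prime p"
    and "ring R"
    and "finite (carrier R)"
    and "\<not> cring R"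
    and "local_ring R"
    and "R Quot jacobson_radical R \<simeq> residue_ring (int p)"
  shows "(\<exists>h \<in> ring_hom R (square_zero_quot (residue_ring (int p))).
            h ` carrier R = carrier (square_zero_quot (residue_ring (int p))))
       \<and> covering_number R = enat (p + 1)
       \<and> \<not> in_S (p + 1) R"
proof -
  interpret R: ring R by (rule assms(2))
  obtain J where J: "maximal_left_ideal J R" "\<And>M. maximal_left_ideal M R \<Longrightarrow> M = J"
    using assms(5) by (auto simp: local_ring_def)
  interpret R: finite_local_ring R J by unfold_locales (rule assms(3), rule J(1), erule J(2))
  have "{M. maximal_left_ideal M R} = {J}" using J by blast
  then have "jacobson_radical R = J"
    unfolding jacobson_radical_def using R.J_carr by auto
  then have iso: "R Quot J \<simeq> residue_ring (int p)" using assms(6) by simp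
  interpret R: finite_local_prime_ring R J p
    by unfold_locales (use assms(1) R.residue_field_decomposition[OF iso assms(1)] in auto)
  obtain n i j a b where coords: "square_zero_coordinates R p n i j a b"
    using R.coordinates_exist[OF assms(4)] by blast
  interpret C: square_zero_coordinates R p n i j a b by (rule coords)
  obtain n' i' j' a' b' where "square_zero_coordinates (R Quot C.ker) p n' i' j' a' b'"
    using C.coordinates_quotient by blast
  \<comment> \<open>Membership in \<open>S(p + 1)\<close> would require a covering number above
    \<open>p + 1\<close> for the quotient by the nonzero ideal \<open>ker\<close>.\<close>
  then have "covering_number (R Quot C.ker) \<le> enat (p + 1)"
    by (rule square_zero_coordinates.covering_number_le)
  then have "\<not> in_S (p + 1) R"
    using C.ideal_ker C.ker_neq_zero[OF assms(4)] unfolding in_S_def not_less[symmetric] by blast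
  moreover have "covering_number R = enat (p + 1)"
    using C.covering_number_le R.covering_number_ge by (rule antisym)
  moreover have "\<exists>h \<in> ring_hom R (square_zero_quot (residue_ring (int p))).
      h ` carrier R = carrier (square_zero_quot (residue_ring (int p)))" (is "\<exists>h \<in> ring_hom R ?Q. _")
  proof -
    obtain X Y where Q: "ring ?Q" "X \<in> carrier ?Q" "Y \<in> carrier ?Q"
      "X \<otimes>\<^bsub>?Q\<^esub> X = \<zero>\<^bsub>?Q\<^esub>" "X \<otimes>\<^bsub>?Q\<^esub> Y = \<zero>\<^bsub>?Q\<^esub>"
      "Y \<otimes>\<^bsub>?Q\<^esub> X = \<zero>\<^bsub>?Q\<^esub>" "Y \<otimes>\<^bsub>?Q\<^esub> Y = \<zero>\<^bsub>?Q\<^esub>"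
      "[int p] \<cdot>\<^bsub>?Q\<^esub> \<one>\<^bsub>?Q\<^esub> = \<zero>\<^bsub>?Q\<^esub>"
      and span: "\<forall>q\<in>carrier ?Q. \<exists>n i j. q = ring.lin_comb ?Q X Y n i j"
      using square_zero_quot_structure[OF assms(1)] by (elim bexE conjE) (rule that)
    show ?thesis using Q bspec[OF span] by (rule C.hom_onto_lin_combs)
  qed
  ultimately show ?thesis by blast
qed

end
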